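(* Let $0<\alpha<2$ and $0<\beta\le1$. The marginal probability density function $f_{\alpha,\beta}(x,t)$ of the generalized grey Brownian motion $\{B_{\alpha,\beta}(t)\}_{t\ge0}$ is the fundamental solution (that is, the solution with initial datum $u_0(x)=\delta(x)$) of the "stretched" time-fractional diffusion equation $$u(x,t)=u_0(x)+\frac{1}{\Gamma(\beta)}\int_0^t\frac{\alpha}{\beta}\,s^{\frac{\alpha}{\beta}-1}\left(t^{\frac{\alpha}{\beta}}-s^{\frac{\alpha}{\beta}}\right)^{\beta-1}\frac{\partial^2}{\partial x^2}u(x,s)\,ds,\qquad t\ge0.$$
   Context: $\mathcal{S}(\mathbb{R})$ is the (real-valued) Schwartz space, a nuclear space, and $\mathcal{S}'(\mathbb{R})$ is its dual, with pairing $\langle\cdot,\cdot\rangle$. $\mathcal{B}$ is the Borel $\sigma$-algebra of the weak topology on $\mathcal{S}'(\mathbb{R})$, i.e. the coarsest topology making $\omega\mapsto\langle\omega,\xi\rangle$ continuous for every $\xi\in\mathcal{S}(\mathbb{R})$. The Fourier transform is $\widetilde f(x)=\frac{1}{\sqrt{2\pi}}\int_{\mathbb{R}}e^{ixy}f(y)\,dy$. For $0<\alpha<2$ set $C(\alpha)=\Gamma(\alpha+1)\sin\frac{\pi\alpha}{2}$ and $$(\xi,\eta)_\alpha=C(\alpha)\int_{\mathbb{R}}\overline{\widetilde\xi(x)}\,\widetilde\eta(x)\,|x|^{1-\alpha}dx,\qquad \|\xi\|_\alpha^2=(\xi,\xi)_\alpha .$$ $\mathcal{S}_0^{(\alpha)}(\mathbb{R})$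 is the completion of $\mathcal{S}(\mathbb{R})$ with respect to $\|\cdot\|_\alpha$. For each $t\ge0$ the indicator function $1_{[0,t)}$ (with $\widetilde 1_{[0,t)}(x)=\frac{1}{\sqrt{2\pi}}\frac{e^{itx}-1}{ix}$) belongs to $\mathcal{S}_0^{(\alpha)}(\mathbb{R})$, and $\|1_{[0,t)}\|_\alpha^2=t^\alpha$. For $\beta>0$ the Mittag-Leffler function is $E_\beta(x)=\sum_{n=0}^\infty \frac{x^n}{\Gamma(\beta n+1)}$, $x\in\mathbb{R}$. For $0<\beta\le1$ the function $t\mapsto E_\beta(-t)$, $t\ge0$, is completely monotone. By Minlos' theorem there is a unique probability measure $\mu_{\alpha,\beta}$ on $(\mathcal{S}'(\mathbb{R}),\mathcal{B})$ with $$\int_{\mathcal{S}'(\mathbb{R})}e^{i\langle\omega,\xi\rangle}d\mu_{\alpha,\beta}(\omega)=E_\beta(-\|\xi\|_\alpha^2),\qquad \xi\in\mathcal{S}(\mathbb{R}).$$ The generalized grey noise $X_{\alpha,\beta}$ is defined on this probability space by $X_{\alpha,\beta}(\varphi)(\omega)=\langle\omega,\varphi\rangle$ for $\varphi\in\mathcal{S}(\mathbb{R})$. For $h\in\mathcal{S}_0^{(\alpha)}(\mathbb{R})$, $X_{\alpha,\beta}(h)$ is the limit in $L^2(\mathcal{S}'(\mathbb{R}),\mu_{\alpha,\beta})$ of $X_{\alpha,\beta}(\xi_n)$ for any sequence $\xi_n\in\mathcal{S}(\mathbb{R})$ converging to $h$ in $\|\cdot\|_\alpha$. The generalized grey Brownian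 motion is the process $B_{\alpha,\beta}(t)=X_{\alpha,\beta}(1_{[0,t)})$, $t\ge0$; $f_{\alpha,\beta}(\cdot,t)$ denotes the probability density of $B_{\alpha,\beta}(t)$, with $f_{\alpha,\beta}(x,0)=\delta(x)$ (Dirac delta) since $B_{\alpha,\beta}(0)=0$ almost surely. The integral equation is understood in the sense of tempered distributions in $x$, i.e. as the equation obtained for each $t\ge 0$ by taking the Fourier transform in the variable $x$ (so $\partial^2/\partial x^2$ becomes multiplication by $-y^2$). *)

theory Defs
  imports "HOL-Probability.Probability"
begin

section \<open>Schwartz functions and tempered distributions\<close>

definition nth_deriv :: "nat \<Rightarrow> (real \<Rightarrow> 'a::real_normed_vector) \<Rightarrow> real \<Rightarrow> 'a" where
  "nth_deriv n f = ((\<lambda>g x. vector_derivative g (at x)) ^^ n) f"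

text \<open>The codomain is left polymorphic: at type \<^typ>\<open>real \<Rightarrow> real\<close> this is the
  real-valued Schwartz space on whose dual the grey noise lives, at type
  \<^typ>\<open>real \<Rightarrow> complex\<close> it is the space of test functions for the
  (complex) tempered distributions, which is stable under the Fourier transform.\<close>

definition schwartz_space :: "(real \<Rightarrow> 'a::real_normed_vector) set" where
  "schwartz_space =
     {f. (\<forall>n x. nth_deriv n f differentiable (at x)) \<and>
         (\<forall>m n. bounded (range (\<lambda>x. x ^ m *\<^sub>R nth_deriv n f x)))}"

definition schwartz_seminorm :: "nat \<Rightarrow> nat \<Rightarrow> (real \<Rightarrow> 'a::real_normed_vector) \<Rightarrow> real" where
  "schwartz_seminorm m n f = (SUP x. norm (x ^ m *\<^sub>R nth_deriv n f x))"

definition schwartz_topology :: "(real \<Rightarrow> 'a::real_normed_vector) topology" where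
  "schwartz_topology = topology_generated_by
     {{g \<in> schwartz_space. schwartz_seminorm m n (\<lambda>x. g x - f x) < r} |
        f m n r. f \<in> schwartz_space \<and> 0 < r}"

text \<open>The dual of the Schwartz space: continuous linear functionals over the scalar field
  \<^typ>\<open>'a\<close> (real or complex).  The condition \<^const>\<open>extensional\<close>
  makes functionals that agree on the Schwartz space equal.\<close>

definition tempered_distributions :: "((real \<Rightarrow> 'a::real_normed_field) \<Rightarrow> 'a) set" where
  "tempered_distributions =
     {T \<in> extensional schwartz_space.
        (\<forall>\<phi>\<in>schwartz_space. \<forall>\<psi>\<in>schwartz_space. \<forall>c.
            T (\<lambda>x. c * \<phi> x + \<psi> x) = c * T \<phi> + T \<psi>) \<and>
        continuous_map schwartz_topology euclidean T}"

definition weak_dual_topology :: "((real \<Rightarrow> real) \<Rightarrow> real) topology" where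
  "weak_dual_topology = topology_generated_by
     {{\<omega> \<in> tempered_distributions. \<omega> \<xi> \<in> U} | \<xi> U. \<xi> \<in> schwartz_space \<and> open U}"

definition weak_dual_borel :: "((real \<Rightarrow> real) \<Rightarrow> real) measure" where
  "weak_dual_borel = sigma tempered_distributions {W. openin weak_dual_topology W}"

definition fourier :: "(real \<Rightarrow> complex) \<Rightarrow> real \<Rightarrow> complex" where
  "fourier f x = complex_of_real (1 / sqrt (2 * pi)) * (LINT y|lborel. cis (x * y) * f y)"

definition fourier_distr :: "((real \<Rightarrow> complex) \<Rightarrow> complex) \<Rightarrow> (real \<Rightarrow> complex) \<Rightarrow> complex" where
  "fourier_distr T = restrict (\<lambda>\<phi>. T (fourier \<phi>)) schwartz_space"

definition mult_distr ::
    "(real \<Rightarrow> complex) \<Rightarrow> ((real \<Rightarrow> complex) \<Rightarrow> complex) \<Rightarrow> (real \<Rightarrow> complex) \<Rightarrow> complex" where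
  "mult_distr p T = restrict (\<lambda>\<phi>. T (\<lambda>y. p y * \<phi> y)) schwartz_space"

definition dirac_distr :: "(real \<Rightarrow> complex) \<Rightarrow> complex" where
  "dirac_distr = restrict (\<lambda>\<phi>. \<phi> 0) schwartz_space"

definition regular_distr :: "(real \<Rightarrow> real) \<Rightarrow> (real \<Rightarrow> complex) \<Rightarrow> complex" where
  "regular_distr g = restrict (\<lambda>\<phi>. LINT x|lborel. complex_of_real (g x) * \<phi> x) schwartz_space"


section \<open>The completion of the Schwartz space\<close>

definition C_const :: "real \<Rightarrow> real" where
  "C_const \<alpha> = Gamma (\<alpha> + 1) * sin (pi * \<alpha> / 2)"

definition alpha_inner :: "real \<Rightarrow> (real \<Rightarrow> real) \<Rightarrow> (real \<Rightarrow> real) \<Rightarrow> complex" where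
  "alpha_inner \<alpha> \<xi> \<eta> = complex_of_real (C_const \<alpha>) *
     (LINT x|lborel. cnj (fourier (\<lambda>y. complex_of_real (\<xi> y)) x) *
        fourier (\<lambda>y. complex_of_real (\<eta> y)) x * complex_of_real (\<bar>x\<bar> powr (1 - \<alpha>)))"

definition alpha_norm :: "real \<Rightarrow> (real \<Rightarrow> real) \<Rightarrow> real" where
  "alpha_norm \<alpha> \<xi> = sqrt (Re (alpha_inner \<alpha> \<xi> \<xi>))"

definition alpha_cauchy :: "real \<Rightarrow> (nat \<Rightarrow> real \<Rightarrow> real) set" where
  "alpha_cauchy \<alpha> =
     {\<xi>. (\<forall>n. \<xi> n \<in> schwartz_space) \<and>
         (\<forall>e>0. \<exists>N. \<forall>m\<ge>N. \<forall>n\<ge>N. alpha_norm \<alpha> (\<lambda>x. \<xi> m x - \<xi> n x) < e)}"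

definition alpha_equiv :: "real \<Rightarrow> ((nat \<Rightarrow> real \<Rightarrow> real) \<times> (nat \<Rightarrow> real \<Rightarrow> real)) set" where
  "alpha_equiv \<alpha> =
     {(\<xi>, \<eta>). \<xi> \<in> alpha_cauchy \<alpha> \<and> \<eta> \<in> alpha_cauchy \<alpha> \<and>
        (\<lambda>n. alpha_norm \<alpha> (\<lambda>x. \<xi> n x - \<eta> n x)) \<longlonglongrightarrow> 0}"

definition S0_space :: "real \<Rightarrow> (nat \<Rightarrow> real \<Rightarrow> real) set set" where
  "S0_space \<alpha> = alpha_cauchy \<alpha> // alpha_equiv \<alpha>"

text \<open>The element of the completion represented by a function \<open>h\<close>: the set of all
  sequences of Schwartz functions converging to \<open>h\<close>.  The integrability conditions rule
  out functions for which \<^const>\<open>alpha_norm\<close> is meaningless (a non-integrable function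
  has Bochner integral 0).  If \<open>h\<close> is not in the completion, the set is empty and hence
  not an element of \<^const>\<open>S0_space\<close>; membership of the indicators
  \<open>1\<^bsub>[0,t)\<^esub>\<close> is not built into the definition.\<close>

definition S0_embed :: "real \<Rightarrow> (real \<Rightarrow> real) \<Rightarrow> (nat \<Rightarrow> real \<Rightarrow> real) set" where
  "S0_embed \<alpha> h =
     {\<xi>. integrable lborel h \<and>
         integrable lborel
           (\<lambda>x. (cmod (fourier (\<lambda>y. complex_of_real (h y)) x))\<^sup>2 * \<bar>x\<bar> powr (1 - \<alpha>)) \<and>
         (\<forall>n. \<xi> n \<in> schwartz_space) \<and>
         (\<lambda>n. alpha_norm \<alpha> (\<lambda>x. \<xi> n x - h x)) \<longlonglongrightarrow> 0}"


section \<open>Generalized grey noise and generalized grey Brownian motion\<close>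

definition Mittag_Leffler :: "real \<Rightarrow> real \<Rightarrow> real" where
  "Mittag_Leffler \<beta> x = (\<Sum>n. x ^ n / Gamma (\<beta> * real n + 1))"

text \<open>The measure given by Minlos' theorem, through its defining property.\<close>

definition is_grey_measure :: "real \<Rightarrow> real \<Rightarrow> ((real \<Rightarrow> real) \<Rightarrow> real) measure \<Rightarrow> bool" where
  "is_grey_measure \<alpha> \<beta> \<mu> \<longleftrightarrow>
     prob_space \<mu> \<and> sets \<mu> = sets weak_dual_borel \<and>
     (\<forall>\<xi>\<in>schwartz_space. (LINT \<omega>|\<mu>. cis (\<omega> \<xi>)) =
         complex_of_real (Mittag_Leffler \<beta> (- (alpha_norm \<alpha> \<xi>)\<^sup>2)))"

text \<open>\<open>X\<close> is (a version of) the generalized grey noise on the completion: \<open>X h\<close> is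
  the \<open>L\<^sup>2\<close> limit of \<open>\<omega> \<mapsto> \<langle>\<omega>, \<xi>\<^sub>n\<rangle>\<close> for every sequence \<open>\<xi>\<close> representing \<open>h\<close>.
  As \<open>L\<^sup>2\<close> limits are determined only almost everywhere, \<open>X\<close> is not unique as a
  function, and results are stated for every such \<open>X\<close>.\<close>

definition is_grey_noise ::
    "real \<Rightarrow> ((real \<Rightarrow> real) \<Rightarrow> real) measure \<Rightarrow>
     ((nat \<Rightarrow> real \<Rightarrow> real) set \<Rightarrow> ((real \<Rightarrow> real) \<Rightarrow> real) \<Rightarrow> real) \<Rightarrow> bool" where
  "is_grey_noise \<alpha> \<mu> X \<longleftrightarrow>
     (\<forall>h\<in>S0_space \<alpha>.
        X h \<in> borel_measurable \<mu> \<and> integrable \<mu> (\<lambda>\<omega>. (X h \<omega>)\<^sup>2) \<and>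
        (\<forall>\<xi>\<in>h. (\<lambda>n. \<integral>\<^sup>+\<omega>. ennreal ((\<omega> (\<xi> n) - X h \<omega>)\<^sup>2) \<partial>\<mu>) \<longlonglongrightarrow> 0))"

definition grey_bm ::
    "real \<Rightarrow> ((nat \<Rightarrow> real \<Rightarrow> real) set \<Rightarrow> ((real \<Rightarrow> real) \<Rightarrow> real) \<Rightarrow> real) \<Rightarrow>
     real \<Rightarrow> ((real \<Rightarrow> real) \<Rightarrow> real) \<Rightarrow> real" where
  "grey_bm \<alpha> X t = X (S0_embed \<alpha> (indicator {0..<t}))"

definition is_marginal_density ::
    "real \<Rightarrow> ((real \<Rightarrow> real) \<Rightarrow> real) measure \<Rightarrow>
     ((nat \<Rightarrow> real \<Rightarrow> real) set \<Rightarrow> ((real \<Rightarrow> real) \<Rightarrow> real) \<Rightarrow> real) \<Rightarrow>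
     (real \<Rightarrow> real \<Rightarrow> real) \<Rightarrow> bool" where
  "is_marginal_density \<alpha> \<mu> X f \<longleftrightarrow>
     (\<forall>t>0. (\<forall>x. 0 \<le> f x t) \<and> distributed \<mu> lborel (grey_bm \<alpha> X t) (\<lambda>x. ennreal (f x t)))"

text \<open>\<open>f(\<cdot>,t)\<close> as a tempered distribution, with the convention \<open>f(x,0) = \<delta>(x)\<close>; the
  values of the function \<open>f\<close> at time 0 are irrelevant.\<close>

definition density_distr ::
    "(real \<Rightarrow> real \<Rightarrow> real) \<Rightarrow> real \<Rightarrow> (real \<Rightarrow> complex) \<Rightarrow> complex" where
  "density_distr f t = (if t = 0 then dirac_distr else regular_distr (\<lambda>x. f x t))"


section \<open>The stretched time-fractional diffusion equation\<close>

definition stretched_kernel :: "real \<Rightarrow> real \<Rightarrow> real \<Rightarrow> real \<Rightarrow> real" where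
  "stretched_kernel \<alpha> \<beta> t s =
     \<alpha> / \<beta> * s powr (\<alpha> / \<beta> - 1) * (t powr (\<alpha> / \<beta>) - s powr (\<alpha> / \<beta>)) powr (\<beta> - 1)"

text \<open>The equation for a family \<open>u\<close> of tempered distributions in the space variable, after
  applying the Fourier transform in that variable, which turns the second space derivative into
  multiplication by \<open>- y\<^sup>2\<close>.  The time integral of distributions is the weak one: for each
  test function the pairing is (absolutely) integrable, and the equation holds after pairing.\<close>

definition solves_stretched_equation ::
    "real \<Rightarrow> real \<Rightarrow> ((real \<Rightarrow> complex) \<Rightarrow> complex) \<Rightarrow>
     (real \<Rightarrow> (real \<Rightarrow> complex) \<Rightarrow> complex) \<Rightarrow> bool" where
  "solves_stretched_equation \<alpha> \<beta> u0 u \<longleftrightarrow>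
     u0 \<in> tempered_distributions \<and>
     (\<forall>t\<ge>0. u t \<in> tempered_distributions) \<and>
     (\<forall>t\<ge>0. \<forall>\<phi>\<in>schwartz_space.
        set_integrable lborel {0..t}
          (\<lambda>s. complex_of_real (stretched_kernel \<alpha> \<beta> t s) *
               mult_distr (\<lambda>y. - (complex_of_real y)\<^sup>2) (fourier_distr (u s)) \<phi>) \<and>
        fourier_distr (u t) \<phi> =
          fourier_distr u0 \<phi> + complex_of_real (1 / Gamma \<beta>) *
            (LINT s:{0..t}|lborel. complex_of_real (stretched_kernel \<alpha> \<beta> t s) *
               mult_distr (\<lambda>y. - (complex_of_real y)\<^sup>2) (fourier_distr (u s)) \<phi>))"

definition is_fundamental_solution ::
    "real \<Rightarrow> real \<Rightarrow> (real \<Rightarrow> (real \<Rightarrow> complex) \<Rightarrow> complex) \<Rightarrow> bool" where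
  "is_fundamental_solution \<alpha> \<beta> u \<longleftrightarrow> solves_stretched_equation \<alpha> \<beta> dirac_distr u"

end

(*
  The L^2 limit defining B(t) passes to characteristic functions, so E exp(i y B(t)) =
  E_beta(- y^2 t^alpha) as soon as the indicator of [0,t) is a norm limit of Schwartz functions and
  has norm^2 equal to t^alpha.  Gaussian mollification gives the approximation: it multiplies the
  Fourier transform by a Gaussian and hence allows dominated convergence.  The squared norm is
  C(alpha) / pi times the integral of (1 - cos(t x)) |x|^(-1-alpha).
  Tested against phi, the Fourier-transformed equation becomes the scalar fractional equation for
  t |-> E_beta(- y^2 t^alpha), integrated against phi(y); the scalar equation is the Mittag-Leffler
  series integrated term by term.
*)
theory Submission
  imports Defs
begin

section \<open>Schwartz functions\<close>

text \<open>A non-integrable function has Bochner integral 0, so no norm estimate is meaningful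
  before integrability is known; \<open>alpha_finite\<close> carries that condition along. The noise
  hypothesis speaks only of elements of \<open>S0_space\<close>, so a sequence approximating the
  indicator must exist before anything can be said about B(t). The approximants are differences G(x)
  - G(x - t) of an antiderivative of a Gaussian: their decay follows from the mean value theorem and
  their transform from the rule for derivatives, with no convolution integral. The constant
  C(\<alpha>) arises as Gamma(\<alpha> + 1), from a Laplace integral, times a sine, from the
  reflection formula. Interchanging the time integral with the pairing needs a bound on E_beta(- y^2
  s^\<alpha>) uniform in y and s; the bound 1 holds because this is the characteristic function of
  B(s). What remains is integrability of the kernel in s and of y^2 \<phi>(y) in y.\<close>

lemma nth_deriv_0: "nth_deriv 0 f = f"
  by (simp add: nth_deriv_def)

text \<open>The derivative is taken off next to f rather than outside, so that an induction on n
  over all functions can pass from f to its derivative.\<close>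

lemma nth_deriv_Suc: "nth_deriv (Suc n) f = nth_deriv n (\<lambda>x. vector_derivative f (at x))"
  unfolding nth_deriv_def by (simp add: funpow_Suc_right del: funpow.simps)

text \<open>A class closed under differentiation contains all iterated derivatives of its members,
  so rapid decay of the members themselves is enough. Each closure property below amounts to a good
  choice of S, and no formula for higher derivatives is ever needed.\<close>

lemma schwartz_space_coinduct:
  fixes f :: "real \<Rightarrow> 'a::real_normed_vector"
  assumes "f \<in> S"
    and deriv: "\<And>f. f \<in> S \<Longrightarrow> \<exists>f'\<in>S. \<forall>x. (f has_vector_derivative f' x) (at x)"
    and bound: "\<And>f m. f \<in> S \<Longrightarrow> \<exists>B. \<forall>x. \<bar>x\<bar> ^ m * norm (f x) \<le> B"
  shows "f \<in> schwartz_space"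
proof -
  have nth: "nth_deriv n g \<in> S" if "g \<in> S" for n g
    using that
  proof (induction n arbitrary: g)
    case (Suc n)
    obtain g' where g': "g' \<in> S" "\<And>x. (g has_vector_derivative g' x) (at x)"
      using deriv[OF Suc.prems] by blast
    then have "(\<lambda>x. vector_derivative g (at x)) = g'"
      by (auto simp: fun_eq_iff intro: vector_derivative_at)
    then show ?case
      using Suc.IH[OF g'(1)] by (simp add: nth_deriv_Suc)
  qed (simp add: nth_deriv_0)
  show ?thesis
    unfolding schwartz_space_def
  proof (intro CollectI conjI allI)
    fix n x
    show "nth_deriv n f differentiable at x"
      using deriv[OF nth[OF \<open>f \<in> S\<close>, of n]] differentiableI_vector by blast
  next
    fix m n
    obtain B where "\<And>x. \<bar>x\<bar> ^ m * norm (nth_deriv n f x) \<le> B"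
      using bound[OF nth[OF \<open>f \<in> S\<close>, of n]] by blast
    then show "bounded (range (\<lambda>x. x ^ m *\<^sub>R nth_deriv n f x))"
      by (auto simp: bounded_iff power_abs)
  qed
qed

lemma schwartz_space_deriv:
  assumes "f \<in> schwartz_space"
  obtains f' where "f' \<in> schwartz_space" "\<And>x. (f has_vector_derivative f' x) (at x)"
proof
  have "nth_deriv n f differentiable at x" "bounded (range (\<lambda>x. x ^ m *\<^sub>R nth_deriv n f x))" for n m x
    using assms by (auto simp: schwartz_space_def)
  from this[where n = "Suc n" for n]
  show "(\<lambda>x. vector_derivative f (at x)) \<in> schwartz_space"
    by (simp add: schwartz_space_def nth_deriv_Suc)
  show "(f has_vector_derivative vector_derivative f (at x)) (at x)" for x
    using assms nth_deriv_0[of f] unfolding schwartz_space_def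
    by (metis (mono_tags, lifting) mem_Collect_eq vector_derivative_works)
qed

lemma schwartz_space_bound:
  assumes "f \<in> schwartz_space"
  obtains B where "0 < B" "\<And>x. \<bar>x\<bar> ^ m * norm (f x) \<le> B"
proof -
  have "bounded (range (\<lambda>x. x ^ m *\<^sub>R nth_deriv 0 f x))"
    using assms by (auto simp: schwartz_space_def)
  then show ?thesis
    using that by (auto simp: bounded_pos nth_deriv_0 power_abs)
qed

lemma schwartz_space_continuous_on: "f \<in> schwartz_space \<Longrightarrow> continuous_on A f"
  by (metis continuous_at_imp_continuous_on has_vector_derivative_continuous schwartz_space_deriv)

lemma schwartz_space_bounded_linear:
  assumes "bounded_linear h" "f \<in> schwartz_space"
  shows "(\<lambda>x. h (f x)) \<in> schwartz_space"
proof (rule schwartz_space_coinduct[where S = "{\<lambda>x. h (f x) |f. f \<in> schwartz_space}"])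
  interpret bounded_linear h by fact
  fix g assume "g \<in> {\<lambda>x. h (f x) |f. f \<in> schwartz_space}"
  then obtain f where f: "f \<in> schwartz_space" "g = (\<lambda>x. h (f x))" by blast
  obtain f' where "f' \<in> schwartz_space" "\<And>x. (f has_vector_derivative f' x) (at x)"
    using f schwartz_space_deriv by blast
  then show "\<exists>f'\<in>{\<lambda>x. h (f x) |f. f \<in> schwartz_space}. \<forall>x. (g has_vector_derivative f' x) (at x)"
    unfolding f(2) using has_vector_derivative by (intro bexI[of _ "\<lambda>x. h (f' x)"]) auto
  fix m
  obtain B where B: "0 < B" "\<And>x. \<bar>x\<bar> ^ m * norm (f x) \<le> B"
    using schwartz_space_bound[OF f(1)] by blast
  obtain K where K: "0 < K" "\<And>x. norm (h x) \<le> norm x * K"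
    using pos_bounded by blast
  have "\<bar>x\<bar> ^ m * norm (g x) \<le> B * K" for x
  proof -
    have "\<bar>x\<bar> ^ m * norm (g x) \<le> \<bar>x\<bar> ^ m * (norm (f x) * K)"
      unfolding f by (intro mult_left_mono K) auto
    also have "\<dots> = (\<bar>x\<bar> ^ m * norm (f x)) * K" by simp
    also have "\<dots> \<le> B * K" using B K by (intro mult_right_mono) auto
    finally show ?thesis .
  qed
  then show "\<exists>B. \<forall>x. \<bar>x\<bar> ^ m * norm (g x) \<le> B" by blast
qed (use assms in blast)

lemma schwartz_space_add:
  assumes "f \<in> schwartz_space" "g \<in> schwartz_space"
  shows "(\<lambda>x. f x + g x) \<in> schwartz_space"
proof (rule schwartz_space_coinduct[where
      S = "{\<lambda>x. f x + g x |f g. f \<in> schwartz_space \<and> g \<in> schwartz_space}"])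
  fix h assume "h \<in> {\<lambda>x. f x + g x |f g. f \<in> schwartz_space \<and> g \<in> schwartz_space}"
  then obtain f g where fg: "f \<in> schwartz_space" "g \<in> schwartz_space" "h = (\<lambda>x. f x + g x)"
    by blast
  obtain f' where "f' \<in> schwartz_space" "\<And>x. (f has_vector_derivative f' x) (at x)"
    using fg schwartz_space_deriv by blast
  moreover obtain g' where "g' \<in> schwartz_space" "\<And>x. (g has_vector_derivative g' x) (at x)"
    using fg schwartz_space_deriv by blast
  ultimately show "\<exists>f'\<in>{\<lambda>x. f x + g x |f g. f \<in> schwartz_space \<and> g \<in> schwartz_space}.
      \<forall>x. (h has_vector_derivative f' x) (at x)"
    unfolding fg(3) by (intro bexI[of _ "\<lambda>x. f' x + g' x"] allI has_vector_derivative_add) auto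
  fix m
  obtain B where B: "\<And>x. \<bar>x\<bar> ^ m * norm (f x) \<le> B"
    using schwartz_space_bound[OF fg(1)] by blast
  obtain C where C: "\<And>x. \<bar>x\<bar> ^ m * norm (g x) \<le> C"
    using schwartz_space_bound[OF fg(2)] by blast
  have "\<bar>x\<bar> ^ m * norm (h x) \<le> B + C" for x
  proof -
    have "\<bar>x\<bar> ^ m * norm (h x) \<le> \<bar>x\<bar> ^ m * (norm (f x) + norm (g x))"
      unfolding fg by (intro mult_left_mono norm_triangle_ineq) auto
    also have "\<dots> \<le> B + C" using B[of x] C[of x] by (simp add: distrib_left)
    finally show ?thesis .
  qed
  then show "\<exists>B. \<forall>x. \<bar>x\<bar> ^ m * norm (h x) \<le> B" by blast
qed (use assms in blast)

lemma schwartz_space_diff: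
  assumes "f \<in> schwartz_space" "g \<in> schwartz_space"
  shows "(\<lambda>x. f x - g x) \<in> schwartz_space"
  using schwartz_space_add[OF assms(1) schwartz_space_bounded_linear[OF
        bounded_linear_minus[OF bounded_linear_ident] assms(2)]] by simp

lemma schwartz_space_mult_ident:
  assumes "f \<in> schwartz_space"
  shows "(\<lambda>x. x *\<^sub>R f x) \<in> schwartz_space"
\<comment> \<open>The derivative of x f(x) is x f'(x) + f(x), so the products x f alone are not
  closed under differentiation; the summand g absorbs the extra f.\<close>
proof (rule schwartz_space_coinduct[where
      S = "{\<lambda>x. x *\<^sub>R f x + g x |f g. f \<in> schwartz_space \<and> g \<in> schwartz_space}"])
  have "(\<lambda>x. f x - f x) \<in> schwartz_space" by (intro schwartz_space_diff assms)
  then show "(\<lambda>x. x *\<^sub>R f x) \<in> {\<lambda>x. x *\<^sub>R f x + g x |f g. f \<in> schwartz_space \<and> g \<in> schwartz_space}"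
    using assms by force
  fix h assume "h \<in> {\<lambda>x. x *\<^sub>R f x + g x |f g. f \<in> schwartz_space \<and> g \<in> schwartz_space}"
  then obtain f g where fg: "f \<in> schwartz_space" "g \<in> schwartz_space" "h = (\<lambda>x. x *\<^sub>R f x + g x)"
    by blast
  obtain f' where f': "f' \<in> schwartz_space" "\<And>x. (f has_vector_derivative f' x) (at x)"
    using fg schwartz_space_deriv by blast
  obtain g' where g': "g' \<in> schwartz_space" "\<And>x. (g has_vector_derivative g' x) (at x)"
    using fg schwartz_space_deriv by blast
  have "(\<lambda>x. x *\<^sub>R f' x + (f x + g' x))
      \<in> {\<lambda>x. x *\<^sub>R f x + g x |f g. f \<in> schwartz_space \<and> g \<in> schwartz_space}"
    using schwartz_space_add[OF fg(1) g'(1)] f'(1)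
    by (intro CollectI exI[of _ f'] exI[of _ "\<lambda>x. f x + g' x"]) auto
  moreover have "(h has_vector_derivative x *\<^sub>R f' x + (f x + g' x)) (at x)" for x
    unfolding fg(3) by (auto intro!: derivative_eq_intros f'(2) g'(2))
  ultimately show "\<exists>f'\<in>{\<lambda>x. x *\<^sub>R f x + g x |f g. f \<in> schwartz_space \<and> g \<in> schwartz_space}.
      \<forall>x. (h has_vector_derivative f' x) (at x)"
    by (intro bexI[of _ "\<lambda>x. x *\<^sub>R f' x + (f x + g' x)"]) auto
  fix m
  obtain B where B: "\<And>x. \<bar>x\<bar> ^ Suc m * norm (f x) \<le> B"
    using schwartz_space_bound[OF fg(1)] by blast
  obtain C where C: "\<And>x. \<bar>x\<bar> ^ m * norm (g x) \<le> C"
    using schwartz_space_bound[OF fg(2)] by blast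
  have "\<bar>x\<bar> ^ m * norm (h x) \<le> B + C" for x
  proof -
    have "\<bar>x\<bar> ^ m * norm (h x) \<le> \<bar>x\<bar> ^ m * (norm (x *\<^sub>R f x) + norm (g x))"
      unfolding fg by (intro mult_left_mono norm_triangle_ineq) auto
    also have "\<dots> \<le> B + C" using B[of x] C[of x] by (simp add: distrib_left mult_ac)
    finally show ?thesis .
  qed
  then show "\<exists>B. \<forall>x. \<bar>x\<bar> ^ m * norm (h x) \<le> B" by blast
qed

text \<open>The larger of |v| and |u - v| is at least |u| / 2. This transfers polynomial decay from
  a point v to any u at bounded distance, as needed for translates and for mean value
  points.\<close>

lemma abs_power_le_shift:
  fixes u v :: real
  shows "\<bar>u\<bar> ^ m \<le> 2 ^ m * (\<bar>v\<bar> ^ m + \<bar>u - v\<bar> ^ m)"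
proof -
  have "\<bar>u\<bar> ^ m \<le> (2 * max \<bar>v\<bar> \<bar>u - v\<bar>) ^ m"
    using abs_triangle_ineq[of v "u - v"] by (intro power_mono) (auto simp: max_def)
  also have "\<dots> = 2 ^ m * (max \<bar>v\<bar> \<bar>u - v\<bar>) ^ m"
    by (simp add: power_mult_distrib)
  also have "\<dots> \<le> 2 ^ m * (\<bar>v\<bar> ^ m + \<bar>u - v\<bar> ^ m)"
    by (intro mult_left_mono) (auto simp: max_def)
  finally show ?thesis .
qed

lemma schwartz_space_shift:
  assumes "f \<in> schwartz_space"
  shows "(\<lambda>x. f (x - a)) \<in> schwartz_space"
proof (rule schwartz_space_coinduct[where S = "{\<lambda>x. f (x - a) |f. f \<in> schwartz_space}"])
  fix g assume "g \<in> {\<lambda>x. f (x - a) |f. f \<in> schwartz_space}"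
  then obtain f where f: "f \<in> schwartz_space" "g = (\<lambda>x. f (x - a))" by blast
  obtain f' where f': "f' \<in> schwartz_space" "\<And>x. (f has_vector_derivative f' x) (at x)"
    using f schwartz_space_deriv by blast
  have "((f \<circ> (\<lambda>x. x - a)) has_vector_derivative (1 *\<^sub>R f' (x - a))) (at x)" for x
    by (intro vector_diff_chain_at f'(2)) (auto intro!: derivative_eq_intros)
  then show "\<exists>f'\<in>{\<lambda>x. f (x - a) |f. f \<in> schwartz_space}. \<forall>x. (g has_vector_derivative f' x) (at x)"
    using f f'(1) by (auto simp: o_def)
  fix m
  obtain B where B: "\<And>x. \<bar>x\<bar> ^ m * norm (f x) \<le> B"
    using schwartz_space_bound[OF f(1)] by blast
  obtain C where C: "\<And>x. \<bar>x\<bar> ^ 0 * norm (f x) \<le> C"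
    using schwartz_space_bound[OF f(1)] by blast
  have "\<bar>x\<bar> ^ m * norm (g x) \<le> 2 ^ m * (B + \<bar>a\<bar> ^ m * C)" for x
  proof -
    have "\<bar>x\<bar> ^ m * norm (g x) \<le> 2 ^ m * (\<bar>x - a\<bar> ^ m + \<bar>a\<bar> ^ m) * norm (f (x - a))"
      unfolding f using abs_power_le_shift[of x m "x - a"] by (intro mult_right_mono) auto
    also have "\<dots> = 2 ^ m * (\<bar>x - a\<bar> ^ m * norm (f (x - a)) + \<bar>a\<bar> ^ m * norm (f (x - a)))"
      by (simp add: algebra_simps)
    also have "\<dots> \<le> 2 ^ m * (B + \<bar>a\<bar> ^ m * C)"
      using B[of "x - a"] C[of "x - a"] by (intro mult_left_mono add_mono) auto
    finally show ?thesis .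
  qed
  then show "\<exists>B. \<forall>x. \<bar>x\<bar> ^ m * norm (g x) \<le> B" by blast
qed (use assms in blast)

text \<open>A single term of the exponential series, all of whose terms are nonnegative, is at most
  the sum.\<close>

lemma power_mult_exp_minus_le_fact:
  fixes u :: real
  assumes "0 \<le> u"
  shows "u ^ k * exp (- u) \<le> fact k"
proof -
  have "(\<Sum>n\<in>{k}. u ^ n /\<^sub>R fact n) \<le> exp u"
    unfolding exp_def using assms by (intro sum_le_suminf summable_exp_generic) auto
  then show ?thesis by (simp add: exp_minus field_simps)
qed

lemma schwartz_space_gaussian:
  assumes "0 < c"
  shows "(\<lambda>x::real. a * exp (- c * x\<^sup>2)) \<in> schwartz_space"
\<comment> \<open>Polynomials times one fixed Gaussian are closed under differentiation: p becomes
  p' - 2 c x p.\<close>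
proof (rule schwartz_space_coinduct[where S = "{\<lambda>x. poly p x * exp (- c * x\<^sup>2) |p. True}"])
  have "(\<lambda>x. a * exp (- c * x\<^sup>2)) = (\<lambda>x. poly [:a:] x * exp (- c * x\<^sup>2))" by simp
  then show "(\<lambda>x. a * exp (- c * x\<^sup>2)) \<in> {\<lambda>x. poly p x * exp (- c * x\<^sup>2) |p. True}" by blast
  fix f assume "f \<in> {\<lambda>x. poly p x * exp (- c * x\<^sup>2) |p. True}"
  then obtain p where f: "f = (\<lambda>x. poly p x * exp (- c * x\<^sup>2))" by blast
  have "(f has_vector_derivative poly (pderiv p + p * [:0, - 2 * c:]) x * exp (- c * x\<^sup>2)) (at x)" for x
    unfolding f has_real_derivative_iff_has_vector_derivative[symmetric]
    by (auto intro!: derivative_eq_intros simp: algebra_simps)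
  then show "\<exists>f'\<in>{\<lambda>x. poly p x * exp (- c * x\<^sup>2) |p. True}. \<forall>x. (f has_vector_derivative f' x) (at x)"
    by (intro bexI[of _ "\<lambda>x. poly (pderiv p + p * [:0, - 2 * c:]) x * exp (- c * x\<^sup>2)"]) blast+
  fix m
  \<comment> \<open>The bound |x|^k \<le> 1 + (x^2)^k leaves only powers of u = c x^2 against exp(-
    u), where the factorial bound applies.\<close>
  have mono: "\<bar>x\<bar> ^ k * exp (- c * x\<^sup>2) \<le> 1 + fact k / c ^ k" for k x
  proof -
    have "\<bar>x\<bar> ^ k \<le> 1 + (x\<^sup>2) ^ k"
    proof (cases "\<bar>x\<bar> \<le> 1")
      case True
      then show ?thesis using power_le_one[of "\<bar>x\<bar>" k] by (simp add: add_increasing2)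
    next
      case False
      then have "\<bar>x\<bar> ^ k \<le> \<bar>x\<bar> ^ (2 * k)" by (intro power_increasing) auto
      also have "\<dots> = (x\<^sup>2) ^ k" by (metis power2_abs power_mult)
      finally show ?thesis by simp
    qed
    then have "\<bar>x\<bar> ^ k * exp (- c * x\<^sup>2) \<le> (1 + (x\<^sup>2) ^ k) * exp (- c * x\<^sup>2)"
      by (intro mult_right_mono) auto
    also have "\<dots> = exp (- (c * x\<^sup>2)) + (c * x\<^sup>2) ^ k * exp (- (c * x\<^sup>2)) / c ^ k"
      using assms by (simp add: field_simps power_mult_distrib)
    also have "\<dots> \<le> 1 + fact k / c ^ k"
      using assms by (intro add_mono divide_right_mono power_mult_exp_minus_le_fact) auto
    finally show ?thesis .
  qed
  have "\<bar>x\<bar> ^ m * norm (f x) \<le> (\<Sum>i\<le>degree p. \<bar>coeff p i\<bar> * (1 + fact (m + i) / c ^ (m + i)))" for x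
  proof -
    have "\<bar>x\<bar> ^ m * norm (f x) \<le> \<bar>x\<bar> ^ m * ((\<Sum>i\<le>degree p. \<bar>coeff p i\<bar> * \<bar>x\<bar> ^ i) * exp (- c * x\<^sup>2))"
      unfolding f poly_altdef
      by (auto intro!: mult_left_mono mult_right_mono order_trans[OF sum_abs] simp: abs_mult power_abs)
    also have "\<dots> = (\<Sum>i\<le>degree p. \<bar>coeff p i\<bar> * (\<bar>x\<bar> ^ (m + i) * exp (- c * x\<^sup>2)))"
      by (simp add: sum_distrib_left sum_distrib_right power_add mult_ac)
    also have "\<dots> \<le> (\<Sum>i\<le>degree p. \<bar>coeff p i\<bar> * (1 + fact (m + i) / c ^ (m + i)))"
      by (intro sum_mono mult_left_mono mono) auto
    finally show ?thesis .
  qed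
  then show "\<exists>B. \<forall>x. \<bar>x\<bar> ^ m * norm (f x) \<le> B" by blast
qed

section \<open>Integrability and decay of Schwartz functions\<close>

lemma integrable_inverse_1_plus_square_lborel: "integrable lborel (\<lambda>x::real. inverse (1 + x\<^sup>2))"
  using integrable_inverse_1_plus_square by (simp add: set_integrable_def)

text \<open>The bounds of order 0 and 2 together bound (1 + x^2) |f(x)|, and 1 / (1 + x^2) is
  integrable.\<close>

lemma schwartz_space_integrable:
  fixes f :: "real \<Rightarrow> 'a::euclidean_space"
  assumes "f \<in> schwartz_space"
  shows "integrable lborel f"
proof -
  obtain B where B: "\<And>x. \<bar>x\<bar> ^ 0 * norm (f x) \<le> B"
    using schwartz_space_bound[OF assms] by blast
  obtain C where C: "\<And>x. \<bar>x\<bar> ^ 2 * norm (f x) \<le> C"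
    using schwartz_space_bound[OF assms] by blast
  have meas: "f \<in> borel_measurable lborel"
    using borel_measurable_continuous_onI[OF schwartz_space_continuous_on[OF assms]] by simp
  have "norm (f x) \<le> (B + C) * inverse (1 + x\<^sup>2)" for x
  proof -
    have "(1 + x\<^sup>2) * norm (f x) \<le> B + C" using B[of x] C[of x] by (simp add: algebra_simps)
    moreover have "0 < 1 + x\<^sup>2" by (simp add: add_pos_nonneg)
    ultimately show ?thesis by (simp add: field_simps)
  qed
  then show ?thesis
    by (intro Bochner_Integration.integrable_bound[OF _ meas, of "\<lambda>x. (B + C) * inverse (1 + x\<^sup>2)"] AE_I2)
       (auto intro!: integrable_inverse_1_plus_square_lborel intro: order_trans[OF _ abs_ge_self])
qed

text \<open>These limits are the vanishing boundary terms in the integration by parts of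
  \<open>fourier_deriv\<close>.\<close>

lemma schwartz_space_tendsto_0:
  fixes f :: "real \<Rightarrow> 'a::real_normed_vector"
  assumes "f \<in> schwartz_space"
  shows "(f \<longlongrightarrow> 0) at_top" "(f \<longlongrightarrow> 0) at_bot"
proof -
  obtain B where B: "\<And>x. \<bar>x\<bar> ^ 1 * norm (f x) \<le> B"
    using schwartz_space_bound[OF assms] by blast
  have le: "norm (f x) \<le> \<bar>B / x\<bar>" if "x \<noteq> 0" for x
    using that B[of x] by (auto simp: field_simps)
  have "((\<lambda>x. B / x) \<longlongrightarrow> 0) at_top" "((\<lambda>x. B / x) \<longlongrightarrow> 0) at_bot"
    by (rule tendsto_divide_0[OF tendsto_const filterlim_at_top_imp_at_infinity[OF filterlim_ident]],
        rule tendsto_divide_0[OF tendsto_const filterlim_at_bot_imp_at_infinity[OF filterlim_ident]])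
  then have "((\<lambda>x. \<bar>B / x\<bar>) \<longlongrightarrow> 0) at_top" "((\<lambda>x. \<bar>B / x\<bar>) \<longlongrightarrow> 0) at_bot"
    using tendsto_rabs_zero by blast+
  moreover have "\<forall>\<^sub>F x in at_top. norm (f x) \<le> \<bar>B / x\<bar>"
    using eventually_at_top_not_equal[of "0::real"] by (rule eventually_mono) (rule le)
  moreover have "\<forall>\<^sub>F x in at_bot. norm (f x) \<le> \<bar>B / x\<bar>"
    using eventually_at_bot_not_equal[of "0::real"] by (rule eventually_mono) (rule le)
  ultimately show "(f \<longlongrightarrow> 0) at_top" "(f \<longlongrightarrow> 0) at_bot"
    by (simp_all only: Lim_null_comparison)
qed

section \<open>The Fourier transform\<close>

lemma has_vector_derivative_cis: "((\<lambda>y. cis (x * y)) has_vector_derivative \<i> * of_real x * cis (x * y)) (at y)"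
  by (auto intro!: derivative_eq_intros has_vector_derivative_real_field simp: cis_conv_exp)

lemma measurable_cis [measurable]: "cis \<in> borel_measurable borel"
  by (intro borel_measurable_continuous_onI continuous_intros)

lemma integrable_cis_mult:
  assumes "integrable lborel f"
  shows "integrable lborel (\<lambda>y. cis (x * y) * f y)"
proof -
  have [measurable]: "f \<in> borel_measurable lborel" using assms by auto
  show ?thesis
    by (rule Bochner_Integration.integrable_bound[OF assms]) (auto simp: norm_mult)
qed

lemma fourier_norm_le:
  assumes "integrable lborel f"
  shows "norm (fourier f x) \<le> 1 / sqrt (2 * pi) * (LINT y|lborel. norm (f y))"
proof -
  have "norm (LINT y|lborel. cis (x * y) * f y) \<le> (LINT y|lborel. norm (cis (x * y) * f y))"
    by (rule integral_norm_bound)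
  then show ?thesis
    unfolding fourier_def norm_mult
    by (auto simp: norm_mult norm_divide real_sqrt_mult divide_right_mono)
qed

text \<open>Second-order Taylor remainder, uniform in the base point a; it gives an explicit error
  when differentiating under the Fourier integral.\<close>

lemma norm_cis_minus_approx: "norm (cis (a + h) - cis a - \<i> * of_real h * cis a) \<le> h\<^sup>2 / 2"
proof -
  have "cis (a + h) - cis a - \<i> * of_real h * cis a = cis a * (cis h - (1 + \<i> * of_real h))"
    by (simp add: cis_mult[symmetric] algebra_simps)
  then have "norm (cis (a + h) - cis a - \<i> * of_real h * cis a) = norm (cis h - (1 + \<i> * of_real h))"
    by (simp add: norm_mult)
  also have "\<dots> \<le> h\<^sup>2 / 2"
    using iexp_approx1[of h 1] by (simp add: cis_conv_exp power2_eq_square)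
  finally show ?thesis .
qed

text \<open>The Taylor error of the kernel is at most ((z - x) y)^2 / 2, and the second moment of
  |f| is finite. Hence the error of the linear approximation is at most K (z - x)^2, with K
  independent of z.\<close>

lemma fourier_has_vector_derivative:
  assumes "f \<in> schwartz_space"
  shows "(fourier f has_vector_derivative fourier (\<lambda>y. \<i> * (y *\<^sub>R f y)) x) (at x)"
proof -
  define c where "c = complex_of_real (1 / sqrt (2 * pi))"
  have f: "integrable lborel f" by (intro schwartz_space_integrable assms)
  have f1: "integrable lborel (\<lambda>y. \<i> * (y *\<^sub>R f y))"
    by (intro integrable_mult_right schwartz_space_integrable schwartz_space_mult_ident assms)
  have "integrable lborel (\<lambda>y. y *\<^sub>R (y *\<^sub>R f y))"
    by (intro schwartz_space_integrable schwartz_space_mult_ident assms)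
  then have f2: "integrable lborel (\<lambda>y. y\<^sup>2 * norm (f y))"
    using integrable_norm by (fastforce simp: power2_eq_square abs_mult)
  define K where "K = norm c * (LINT y|lborel. y\<^sup>2 * norm (f y)) / 2"
  have bd: "norm (fourier f z - fourier f x - (z - x) *\<^sub>R fourier (\<lambda>y. \<i> * (y *\<^sub>R f y)) x) \<le> K * (z - x)\<^sup>2" for z
  proof -
    have "fourier f z - fourier f x - (z - x) *\<^sub>R fourier (\<lambda>y. \<i> * (y *\<^sub>R f y)) x
        = c * (LINT y|lborel. cis (z * y) * f y - cis (x * y) * f y
                - (z - x) *\<^sub>R (cis (x * y) * (\<i> * (y *\<^sub>R f y))))"
      unfolding fourier_def c_def[symmetric]
      using integrable_cis_mult[OF f] integrable_cis_mult[OF f1]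
      by (simp add: right_diff_distrib scaleR_conv_of_real)
    also have "norm \<dots> \<le> norm c * (LINT y|lborel. (z - x)\<^sup>2 / 2 * (y\<^sup>2 * norm (f y)))"
      unfolding norm_mult
    proof (intro mult_left_mono order_trans[OF integral_norm_bound] integral_mono)
      fix y
      have "cis (z * y) * f y - cis (x * y) * f y - (z - x) *\<^sub>R (cis (x * y) * (\<i> * (y *\<^sub>R f y)))
         = (cis (x * y + (z - x) * y) - cis (x * y) - \<i> * of_real ((z - x) * y) * cis (x * y)) * f y"
        by (simp add: scaleR_conv_of_real algebra_simps)
      also have "norm \<dots> \<le> ((z - x) * y)\<^sup>2 / 2 * norm (f y)"
        unfolding norm_mult by (intro mult_right_mono norm_cis_minus_approx) auto
      finally show "norm (cis (z * y) * f y - cis (x * y) * f y - (z - x) *\<^sub>R (cis (x * y) * (\<i> * (y *\<^sub>R f y))))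
          \<le> (z - x)\<^sup>2 / 2 * (y\<^sup>2 * norm (f y))"
        by (simp add: power_mult_distrib)
    qed (intro integrable_cis_mult f f1 f2 Bochner_Integration.integrable_diff integrable_norm
          integrable_scaleR_right integrable_mult_right norm_ge_zero)+
    also have "\<dots> = K * (z - x)\<^sup>2" by (simp add: K_def)
    finally show ?thesis .
  qed
  show ?thesis
    unfolding has_vector_derivative_def has_derivative_at_within
  proof (rule conjI[OF bounded_linear_scaleR_left], rule Lim_null_comparison[where g = "\<lambda>z. K * \<bar>z - x\<bar>"])
    show "\<forall>\<^sub>F z in at x. norm ((fourier f z - fourier f x - (z - x) *\<^sub>R fourier (\<lambda>y. \<i> * (y *\<^sub>R f y)) x) /\<^sub>R norm (z - x)) \<le> K * \<bar>z - x\<bar>"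
    proof (rule eventually_at_filter[THEN iffD2], rule eventuallyI, intro impI)
      fix z assume "z \<noteq> x"
      have "norm ((fourier f z - fourier f x - (z - x) *\<^sub>R fourier (\<lambda>y. \<i> * (y *\<^sub>R f y)) x) /\<^sub>R norm (z - x))
          = norm (fourier f z - fourier f x - (z - x) *\<^sub>R fourier (\<lambda>y. \<i> * (y *\<^sub>R f y)) x) / \<bar>z - x\<bar>"
        unfolding norm_scaleR by (simp only: divide_inverse_commute real_norm_def abs_inverse abs_abs)
      also have "\<dots> \<le> K * (z - x)\<^sup>2 / \<bar>z - x\<bar>"
        by (intro divide_right_mono bd) auto
      also have "\<dots> = K * (\<bar>z - x\<bar> * \<bar>z - x\<bar>) / \<bar>z - x\<bar>"
        by (simp add: power2_eq_square)
      also have "\<dots> = K * \<bar>z - x\<bar>"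
        using \<open>z \<noteq> x\<close> by (simp del: abs_mult_self_eq)
      finally show "norm ((fourier f z - fourier f x - (z - x) *\<^sub>R fourier (\<lambda>y. \<i> * (y *\<^sub>R f y)) x) /\<^sub>R norm (z - x)) \<le> K * \<bar>z - x\<bar>" .
    qed
    show "((\<lambda>z. K * \<bar>z - x\<bar>) \<longlongrightarrow> 0) (at x)"
      by (auto intro!: tendsto_eq_intros)
  qed
qed

text \<open>The derivative of cis(x y) f(y) in y integrates to 0 over the line, because f vanishes
  at both ends. The minus sign comes from the kernel exp(i x y).\<close>

lemma fourier_deriv:
  assumes "f \<in> schwartz_space" "f' \<in> schwartz_space"
    and f': "\<And>x. (f has_vector_derivative f' x) (at x)"
  shows "fourier f' x = - \<i> * of_real x * fourier f x"
proof -
  have f: "integrable lborel f" "integrable lborel f'"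
    by (intro schwartz_space_integrable assms)+
  define g where "g y = cis (x * y) * f' y + \<i> * of_real x * (cis (x * y) * f y)" for y
  have g: "((\<lambda>y. cis (x * y) * f y) has_vector_derivative g y) (at y)" for y
    using has_vector_derivative_mult[OF has_vector_derivative_cis[of x y] f'[of y]]
    by (simp add: g_def mult_ac)
  have int: "integrable lborel g"
    unfolding g_def by (intro Bochner_Integration.integrable_add integrable_mult_right integrable_cis_mult f)
  have lim: "((\<lambda>y. cis (x * y) * f y) \<longlongrightarrow> 0) F" if "(f \<longlongrightarrow> 0) F" for F
    using tendsto_norm_zero[OF that] by (subst tendsto_norm_zero_iff[symmetric]) (simp add: norm_mult)
  have "(LBINT y=-\<infinity>..\<infinity>. g y) = 0 - 0"
  proof (rule interval_integral_FTC_integrable[where F = "\<lambda>y. cis (x * y) * f y"])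
    show "isCont g y" for y
      unfolding g_def
      using schwartz_space_continuous_on[OF assms(1), of UNIV] schwartz_space_continuous_on[OF assms(2), of UNIV]
      by (auto intro!: continuous_intros has_vector_derivative_continuous[OF has_vector_derivative_cis]
          simp: continuous_on_eq_continuous_at)
  qed (use g int lim schwartz_space_tendsto_0[OF assms(1)] in
      \<open>auto simp: set_integrable_def ereal_tendsto_simps\<close>)
  then have "(LINT y|lborel. g y) = 0"
    by (simp add: interval_lebesgue_integral_def set_lebesgue_integral_def)
  then have "(LINT y|lborel. cis (x * y) * f' y) = - \<i> * of_real x * (LINT y|lborel. cis (x * y) * f y)"
    unfolding g_def using integrable_cis_mult[OF f(1)] integrable_cis_mult[OF f(2)]
    by (simp add: add_eq_0_iff)
  then show ?thesis unfolding fourier_def by simp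
qed

lemma fourier_schwartz_space:
  assumes "f \<in> schwartz_space"
  shows "fourier f \<in> schwartz_space"
\<comment> \<open>The range of the transform is itself closed under differentiation, since the
  derivative is the transform of i y f(y).\<close>
proof (rule schwartz_space_coinduct[where S = "fourier ` schwartz_space"])
  fix h assume "h \<in> fourier ` (schwartz_space :: (real \<Rightarrow> complex) set)"
  then obtain f where f: "f \<in> schwartz_space" "h = fourier f" by blast
  have "(\<lambda>y. \<i> * (y *\<^sub>R f y)) \<in> schwartz_space"
    by (intro schwartz_space_bounded_linear[OF bounded_linear_mult_right] schwartz_space_mult_ident f)
  then show "\<exists>f'\<in>fourier ` schwartz_space. \<forall>x. (h has_vector_derivative f' x) (at x)"
    using fourier_has_vector_derivative[OF f(1)] f(2) by blast
  fix m
  show "\<exists>B. \<forall>x. \<bar>x\<bar> ^ m * norm (h x) \<le> B"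
    unfolding f(2) using f(1)
  \<comment> \<open>In modulus, x times the transform of f is the transform of f', so each power of
    x is traded for one derivative of f; f must vary.\<close>
  proof (induction m arbitrary: f)
    case 0
    then show ?case using fourier_norm_le[OF schwartz_space_integrable] by auto
  next
    case (Suc m)
    obtain f' where f': "f' \<in> schwartz_space" "\<And>x. (f has_vector_derivative f' x) (at x)"
      using Suc.prems schwartz_space_deriv by blast
    have "norm (fourier f' x) = \<bar>x\<bar> * norm (fourier f x)" for x
      using fourier_deriv[OF Suc.prems f'] by (simp add: norm_mult)
    then show ?case using Suc.IH[OF f'(1)] by (simp add: mult_ac)
  qed
qed (use assms in blast)

section \<open>Tempered distributions of order zero\<close>

lemma schwartz_space_zero: "(\<lambda>x. 0) \<in> schwartz_space"
  by (rule schwartz_space_coinduct[where S = "{\<lambda>x. 0}"]) auto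

lemma schwartz_seminorm_0_0: "schwartz_seminorm 0 0 f = (SUP x. norm (f x))"
  by (simp add: schwartz_seminorm_def nth_deriv_0)

lemma schwartz_seminorm_0_0_upper:
  assumes "f \<in> schwartz_space"
  shows "norm (f x) \<le> schwartz_seminorm 0 0 f"
proof -
  obtain B where "\<And>x. \<bar>x\<bar> ^ 0 * norm (f x) \<le> B"
    using schwartz_space_bound[OF assms] by blast
  then have "bdd_above (range (\<lambda>x. norm (f x)))"
    by (intro bdd_aboveI2[where M = B]) simp
  then show ?thesis
    unfolding schwartz_seminorm_0_0 by (intro cSUP_upper) auto
qed

lemma openin_schwartz_topology_ball:
  "\<phi> \<in> schwartz_space \<Longrightarrow> 0 < r \<Longrightarrow>
    openin schwartz_topology {g \<in> schwartz_space. schwartz_seminorm 0 0 (\<lambda>x. g x - \<phi> x) < r}"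
  unfolding schwartz_topology_def by (rule topology_generated_by_Basis) blast

lemma topspace_schwartz_topology:
  "topspace schwartz_topology = (schwartz_space :: (real \<Rightarrow> 'a::real_normed_vector) set)"
    (is "?L = ?R")
proof
  show "?L \<subseteq> ?R"
    unfolding schwartz_topology_def by auto
  show "?R \<subseteq> ?L"
  proof
    fix \<phi> :: "real \<Rightarrow> 'a" assume "\<phi> \<in> schwartz_space"
    then have "\<phi> \<in> {g \<in> schwartz_space. schwartz_seminorm 0 0 (\<lambda>x. g x - \<phi> x) < 1}"
      by (simp add: schwartz_seminorm_0_0)
    then show "\<phi> \<in> topspace schwartz_topology"
      using openin_subset[OF openin_schwartz_topology_ball[OF \<open>\<phi> \<in> schwartz_space\<close>, of 1]] by auto
  qed
qed

text \<open>The sup norm is the seminorm with both indices 0, whose balls are among the generating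
  open sets; a bound by it alone therefore gives continuity. Both the Dirac functional and
  integration against an integrable function satisfy such a bound.\<close>

lemma tempered_distributions_sup_boundI:
  fixes T :: "(real \<Rightarrow> 'a::real_normed_field) \<Rightarrow> 'a"
  assumes ext: "T \<in> extensional schwartz_space"
    and lin: "\<And>\<phi> \<psi> c. \<phi> \<in> schwartz_space \<Longrightarrow> \<psi> \<in> schwartz_space \<Longrightarrow>
      T (\<lambda>x. c * \<phi> x + \<psi> x) = c * T \<phi> + T \<psi>"
    and bound: "\<And>\<phi> B. \<phi> \<in> schwartz_space \<Longrightarrow> (\<And>x. norm (\<phi> x) \<le> B) \<Longrightarrow> norm (T \<phi>) \<le> K * B"
  shows "T \<in> tempered_distributions"
proof -
  have "openin schwartz_topology {\<phi> \<in> schwartz_space. T \<phi> \<in> U}" if "open U" for U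
  proof (subst openin_subopen, intro ballI)
    fix \<phi> assume "\<phi> \<in> {\<phi> \<in> schwartz_space. T \<phi> \<in> U}"
    then have \<phi>: "\<phi> \<in> schwartz_space" "T \<phi> \<in> U" by auto
    obtain e where e: "0 < e" "ball (T \<phi>) e \<subseteq> U"
      using \<open>open U\<close> \<phi>(2) by (auto simp: open_contains_ball)
    \<comment> \<open>Using |K| + 1 makes the radius well defined and positive whatever the sign of
      K.\<close>
    define V where "V = {g \<in> schwartz_space. schwartz_seminorm 0 0 (\<lambda>x. g x - \<phi> x) < e / (\<bar>K\<bar> + 1)}"
    have "openin schwartz_topology V"
      unfolding V_def using \<phi>(1) e(1) by (intro openin_schwartz_topology_ball) auto
    moreover have "\<phi> \<in> V"
      unfolding V_def using \<phi>(1) e(1) by (simp add: schwartz_seminorm_0_0)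
    moreover have "V \<subseteq> {\<phi> \<in> schwartz_space. T \<phi> \<in> U}"
    proof safe
      fix g assume "g \<in> V"
      define B where "B = schwartz_seminorm 0 0 (\<lambda>x. g x - \<phi> x)"
      have g: "g \<in> schwartz_space" "B < e / (\<bar>K\<bar> + 1)"
        using \<open>g \<in> V\<close> by (auto simp: V_def B_def)
      show "g \<in> schwartz_space" by fact
      have d: "(\<lambda>x. g x - \<phi> x) \<in> schwartz_space" by (intro schwartz_space_diff g \<phi>)
      have B: "norm (g x - \<phi> x) \<le> B" for x
        unfolding B_def by (rule schwartz_seminorm_0_0_upper[OF d])
      then have "0 \<le> B" using norm_ge_zero order_trans by blast
      have "T (\<lambda>x. g x - \<phi> x) = T g - T \<phi>"
        using lin[OF \<phi>(1) g(1), of "-1"] by simp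
      then have "norm (T g - T \<phi>) \<le> K * B"
        using bound[OF d B] by simp
      also have "\<dots> \<le> (\<bar>K\<bar> + 1) * B"
        using \<open>0 \<le> B\<close> by (intro mult_right_mono) auto
      also have "\<dots> < e" using g(2) by (simp add: pos_less_divide_eq mult.commute add_nonneg_pos)
      finally have "T g \<in> ball (T \<phi>) e" by (simp add: dist_norm norm_minus_commute)
      then show "T g \<in> U" using e by blast
    qed
    ultimately show "\<exists>V. openin schwartz_topology V \<and> \<phi> \<in> V \<and> V \<subseteq> {\<phi> \<in> schwartz_space. T \<phi> \<in> U}"
      by blast
  qed
  then show ?thesis
    unfolding tempered_distributions_def
    using ext lin by (auto simp: continuous_map_def topspace_schwartz_topology)
qed

text \<open>Linearity is given in the joint form c \<phi> + \<psi>, so T 0 = 0 comes first and then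
  \<psi> = 0 is taken. This lets a frequency y be moved into the test function.\<close>

lemma tempered_distribution_scale:
  assumes T: "T \<in> tempered_distributions" and \<phi>: "\<phi> \<in> schwartz_space"
  shows "T (\<lambda>x. c * \<phi> x) = c * T \<phi>"
proof -
  have lin: "T (\<lambda>x. c * \<phi> x + \<psi> x) = c * T \<phi> + T \<psi>"
    if "\<phi> \<in> schwartz_space" "\<psi> \<in> schwartz_space" for c \<phi> \<psi>
    using T that unfolding tempered_distributions_def by blast
  have "T (\<lambda>x. 0) = 0"
    using lin[OF schwartz_space_zero schwartz_space_zero, of 1] by simp
  then show ?thesis
    using lin[OF \<phi> schwartz_space_zero, of c] by simp
qed

lemma dirac_distr_tempered: "dirac_distr \<in> tempered_distributions"
proof (rule tempered_distributions_sup_boundI[where K = 1])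
  fix \<phi> \<psi> :: "real \<Rightarrow> complex" and c
  assume *: "\<phi> \<in> schwartz_space" "\<psi> \<in> schwartz_space"
  then have "(\<lambda>x. c * \<phi> x + \<psi> x) \<in> schwartz_space"
    by (intro schwartz_space_add schwartz_space_bounded_linear[OF bounded_linear_mult_right])
  then show "dirac_distr (\<lambda>x. c * \<phi> x + \<psi> x) = c * dirac_distr \<phi> + dirac_distr \<psi>"
    using * by (simp add: dirac_distr_def)
qed (auto simp: dirac_distr_def)

lemma integrable_mult_bounded_continuous:
  fixes g :: "real \<Rightarrow> real" and \<phi> :: "real \<Rightarrow> complex"
  assumes g: "integrable lborel g" and \<phi>: "continuous_on UNIV \<phi>" "\<And>x. norm (\<phi> x) \<le> B"
  shows "integrable lborel (\<lambda>x. complex_of_real (g x) * \<phi> x)"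
proof -
  have [measurable]: "\<phi> \<in> borel_measurable borel" "g \<in> borel_measurable borel"
    using \<phi>(1) g by (auto intro: borel_measurable_continuous_onI)
  show ?thesis
  proof (rule Bochner_Integration.integrable_bound[OF integrable_mult_right[OF g, of B]])
    show "AE x in lborel. norm (complex_of_real (g x) * \<phi> x) \<le> norm (B * g x)"
    proof (intro AE_I2)
      fix x
      have "norm (complex_of_real (g x) * \<phi> x) \<le> \<bar>g x\<bar> * \<bar>B\<bar>"
        unfolding norm_mult using order_trans[OF \<phi>(2) abs_ge_self] by (intro mult_mono) auto
      then show "norm (complex_of_real (g x) * \<phi> x) \<le> norm (B * g x)"
        by (simp add: abs_mult mult.commute)
    qed
  qed simp
qed

lemma regular_distr_tempered:
  assumes g: "integrable lborel g"
  shows "regular_distr g \<in> tempered_distributions"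
proof (rule tempered_distributions_sup_boundI[where K = "LINT x|lborel. \<bar>g x\<bar>"])
  have int: "integrable lborel (\<lambda>x. complex_of_real (g x) * \<phi> x)" if "\<phi> \<in> schwartz_space" for \<phi>
    by (rule schwartz_space_bound[OF that, where m = 0])
      (intro integrable_mult_bounded_continuous g schwartz_space_continuous_on[OF that], simp)
  fix \<phi> \<psi> :: "real \<Rightarrow> complex" and c
  assume *: "\<phi> \<in> schwartz_space" "\<psi> \<in> schwartz_space"
  then have "(\<lambda>x. c * \<phi> x + \<psi> x) \<in> schwartz_space"
    by (intro schwartz_space_add schwartz_space_bounded_linear[OF bounded_linear_mult_right])
  moreover have "(LINT x|lborel. complex_of_real (g x) * (c * \<phi> x + \<psi> x))
      = (LINT x|lborel. c * (complex_of_real (g x) * \<phi> x) + complex_of_real (g x) * \<psi> x)"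
    by (simp add: algebra_simps)
  ultimately show "regular_distr g (\<lambda>x. c * \<phi> x + \<psi> x) = c * regular_distr g \<phi> + regular_distr g \<psi>"
    using * int[OF *(1)] int[OF *(2)] by (simp add: regular_distr_def)
next
  fix \<phi> :: "real \<Rightarrow> complex" and B
  assume \<phi>: "\<phi> \<in> schwartz_space" "\<And>x. norm (\<phi> x) \<le> B"
  have "norm (regular_distr g \<phi>) \<le> (LINT x|lborel. norm (complex_of_real (g x) * \<phi> x))"
    using \<phi>(1) by (simp add: regular_distr_def)
  also have "\<dots> \<le> (LINT x|lborel. \<bar>g x\<bar> * B)"
    using \<phi> schwartz_space_continuous_on[OF \<phi>(1)]
    by (intro integral_mono integrable_norm integrable_mult_bounded_continuous g integrable_mult_left
        integrable_abs) (auto simp: norm_mult intro!: mult_left_mono)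
  finally show "norm (regular_distr g \<phi>) \<le> (LINT x|lborel. \<bar>g x\<bar>) * B" by simp
qed (simp add: regular_distr_def)

section \<open>The Mittag-Leffler function\<close>

text \<open>The Gamma integral restricted to [R, \<infinity>), where t^a \<ge> R^a, already has this
  size. R stays free so that it can be adapted to the argument of the Mittag-Leffler series.\<close>

lemma powr_mult_exp_minus_le_Gamma:
  fixes a R :: real
  assumes "0 \<le> a" "0 < R"
  shows "R powr a * exp (- R) \<le> Gamma (a + 1)"
proof -
  have "((\<lambda>t. R powr a * exp (- 1 * t)) has_integral R powr a * (exp (- 1 * R) / 1)) {R..}"
    by (intro has_integral_mult_right has_integral_exp_minus_to_infinity) auto
  then have "((\<lambda>t. if t \<in> {R..} then R powr a * exp (- t) else 0) has_integral R powr a * exp (- R)) {0..}"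
    using assms by (subst has_integral_restrict) auto
  moreover have "((\<lambda>t. t powr a / exp t) has_integral Gamma (a + 1)) {0..}"
    using Gamma_integral_real[of "a + 1"] assms by simp
  ultimately show ?thesis
    by (rule has_integral_le) (use assms in \<open>auto simp: exp_minus divide_inverse intro!: mult_right_mono powr_mono2\<close>)
qed

lemma summable_Mittag_Leffler_abs:
  assumes "0 < \<beta>"
  shows "summable (\<lambda>n. \<bar>x ^ n / Gamma (\<beta> * real n + 1)\<bar>)"
proof (rule summable_comparison_test')
  \<comment> \<open>With this R, R^(\<beta> n) = (2 |x| + 1)^n, so the Gamma bound makes the n-th
    term at most exp(R) (|x| / (2 |x| + 1))^n. That ratio is at most 1/2, and the added 1 keeps the
    denominator positive at x = 0.\<close>
  define R where "R = (2 * \<bar>x\<bar> + 1) powr (1 / \<beta>)"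
  show "summable (\<lambda>n. exp R * (1 / 2) ^ n)"
    by (intro summable_mult summable_geometric) auto
  fix n
  have pos: "0 < (2 * \<bar>x\<bar> + 1) ^ n" "0 < R" by (auto simp: R_def add_nonneg_pos)
  have "R powr (\<beta> * real n) = (2 * \<bar>x\<bar> + 1) ^ n"
    using assms by (simp add: R_def powr_powr powr_realpow)
  then have "(2 * \<bar>x\<bar> + 1) ^ n * exp (- R) \<le> Gamma (\<beta> * real n + 1)"
    using powr_mult_exp_minus_le_Gamma[of "\<beta> * real n" R] assms pos by simp
  then have "\<bar>x\<bar> ^ n / Gamma (\<beta> * real n + 1) \<le> \<bar>x\<bar> ^ n / ((2 * \<bar>x\<bar> + 1) ^ n * exp (- R))"
    using pos by (intro divide_left_mono mult_pos_pos Gamma_real_pos)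
      (use assms in \<open>auto intro: add_nonneg_pos\<close>)
  also have "\<dots> = exp R * (\<bar>x\<bar> / (2 * \<bar>x\<bar> + 1)) ^ n"
    by (simp add: power_divide exp_minus field_simps)
  also have "\<dots> \<le> exp R * (1 / 2) ^ n"
    by (intro mult_left_mono power_mono) (auto simp: field_simps)
  finally have "\<bar>x\<bar> ^ n / Gamma (\<beta> * real n + 1) \<le> exp R * (1 / 2) ^ n" .
  moreover have "0 < Gamma (\<beta> * real n + 1)"
    using assms by (intro Gamma_real_pos add_nonneg_pos) auto
  ultimately show "norm \<bar>x ^ n / Gamma (\<beta> * real n + 1)\<bar> \<le> exp R * (1 / 2) ^ n"
    by (simp add: power_abs)
qed

lemma Mittag_Leffler_sums:
  assumes "0 < \<beta>"
  shows "(\<lambda>n. x ^ n / Gamma (\<beta> * real n + 1)) sums Mittag_Leffler \<beta> x"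
  unfolding Mittag_Leffler_def
  by (rule summable_sums[OF summable_rabs_cancel[OF summable_Mittag_Leffler_abs[OF assms]]])

lemma isCont_Mittag_Leffler:
  assumes "0 < \<beta>"
  shows "isCont (Mittag_Leffler \<beta>) x"
proof -
  have "isCont (\<lambda>x. \<Sum>n. 1 / Gamma (\<beta> * real n + 1) * x ^ n) x"
  proof (rule isCont_powser)
    show "summable (\<lambda>n. 1 / Gamma (\<beta> * real n + 1) * (\<bar>x\<bar> + 1) ^ n)"
      using Mittag_Leffler_sums[OF assms, of "\<bar>x\<bar> + 1"] by (simp add: sums_iff)
  qed simp
  then show ?thesis by (simp add: Mittag_Leffler_def[abs_def])
qed

lemma Mittag_Leffler_0: "Mittag_Leffler \<beta> 0 = 1"
proof -
  have "(\<Sum>n. 1 / Gamma (\<beta> * real n + 1) * 0 ^ n) = 1"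
    by (subst powser_zero) simp
  then show ?thesis by (simp add: Mittag_Leffler_def)
qed

section \<open>Beta integrals\<close>

text \<open>The substitution v = g s in the Euler integral of v^(a-1) (1-v)^(b-1) over (0,1). The
  change of variables is made for absolute gauge integrals on \<open>lebesgue\<close>; Borel
  measurability of \<open>h\<close> brings the result back to \<open>lborel\<close>. Since
  \<open>h\<close> is prescribed on S only, it can be left in its natural form elsewhere.\<close>

lemma Beta_substitution:
  fixes g g' h :: "real \<Rightarrow> real"
  assumes S: "S \<in> sets borel"
    and deriv: "\<And>s. s \<in> S \<Longrightarrow> (g has_field_derivative g' s) (at s)"
    and inj: "inj_on g S" and img: "g ` S = {0<..<1}"
    and ab: "0 < a" "0 < b"
    and [measurable]: "h \<in> borel_measurable borel"
    and h: "\<And>s. s \<in> S \<Longrightarrow> h s = c * (\<bar>g' s\<bar> * (g s powr (a - 1) * (1 - g s) powr (b - 1)))"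
  shows "set_integrable lborel S h" "(LINT s:S|lborel. h s) = c * Beta a b"
proof -
  define F where "F t = t powr (a - 1) * (1 - t) powr (b - 1)" for t :: real
  have "(F has_integral Beta a b) {0<..<1}"
    unfolding F_def using has_integral_Beta_real[OF ab] by (simp add: has_integral_Icc_iff_Ioo)
  then have F: "F absolutely_integrable_on g ` S" "integral (g ` S) F = Beta a b"
    unfolding img by (auto intro!: nonnegative_absolutely_integrable_1 simp: integral_unique F_def)
  have "(\<lambda>x. \<bar>g' x\<bar> * F (g x)) absolutely_integrable_on S \<and> integral S (\<lambda>x. \<bar>g' x\<bar> * F (g x)) = Beta a b"
    using F S inj deriv
    by (subst has_absolute_integral_change_of_variables_1') (auto intro: DERIV_subset)
  then have ai: "(\<lambda>x. c * (\<bar>g' x\<bar> * F (g x))) absolutely_integrable_on S"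
      "integral S (\<lambda>x. c * (\<bar>g' x\<bar> * F (g x))) = c * Beta a b"
    by (auto intro: set_integrable_mult_right)
  have eq: "h absolutely_integrable_on S \<longleftrightarrow> (\<lambda>x. c * (\<bar>g' x\<bar> * F (g x))) absolutely_integrable_on S"
    by (intro set_integrable_cong refl) (simp add: h F_def)
  have meas: "(\<lambda>x. indicator S x *\<^sub>R h x) \<in> borel_measurable lborel"
    using S by simp
  show "set_integrable lborel S h"
    using ai(1) eq integrable_completion[OF meas] unfolding set_integrable_def by simp
  have "(LINT s:S|lborel. h s) = (LINT s:S|lebesgue. h s)"
    using integral_completion[OF meas] unfolding set_lebesgue_integral_def by simp
  also have "\<dots> = integral S h"
    using ai(1) eq by (intro set_lebesgue_integral_eq_integral) simp
  also have "\<dots> = c * Beta a b"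
    unfolding ai(2)[symmetric] by (intro Henstock_Kurzweil_Integration.integral_cong) (simp add: h F_def)
  finally show "(LINT s:S|lborel. h s) = c * Beta a b" .
qed

section \<open>The stretched kernel and the scalar fractional equation\<close>

lemma stretched_kernel_measurable [measurable]: "stretched_kernel \<alpha> \<beta> t \<in> borel_measurable borel"
  unfolding stretched_kernel_def[abs_def] by measurable

lemma stretched_kernel_nonneg: "0 < \<alpha> \<Longrightarrow> 0 < \<beta> \<Longrightarrow> 0 \<le> stretched_kernel \<alpha> \<beta> t s"
  by (simp add: stretched_kernel_def)

text \<open>The substitution v = (s / t)^(\<alpha> / \<beta>) turns \<alpha> / \<beta>
  s^(\<alpha>/\<beta>-1) ds into t^(\<alpha>/\<beta>) dv, the difference of powers into a multiple
  of 1 - v, and s^(\<alpha> p) into a multiple of v^(\<beta> p). The powers of t add up to \<alpha>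
  (p + 1). The n-th Mittag-Leffler term is the case p = n.\<close>

lemma stretched_kernel_powr:
  assumes "0 < \<alpha>" "0 < \<beta>" "0 < t" "0 \<le> p"
  shows "set_integrable lborel {0..t} (\<lambda>s. stretched_kernel \<alpha> \<beta> t s * s powr (\<alpha> * p))"
    and "(LINT s:{0..t}|lborel. stretched_kernel \<alpha> \<beta> t s * s powr (\<alpha> * p)) =
           t powr (\<alpha> * (p + 1)) * Beta (\<beta> * p + 1) \<beta>"
proof -
  define k where "k = \<alpha> / \<beta>"
  have k: "0 < k" using assms by (simp add: k_def)
  define h where "h s = stretched_kernel \<alpha> \<beta> t s * s powr (\<alpha> * p)" for s
  define g where "g s = (s / t) powr k" for s
  define g' where "g' s = k * (s / t) powr (k - 1) / t" for s
  \<comment> \<open>Since \<open>0 powr a\<close> is 0 for every a, the integrand vanishes at both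
    end points, even where the kernel would be unbounded.\<close>
  have ind: "indicator {0..t} s *\<^sub>R h s = indicator {0<..<t} s *\<^sub>R h s" for s
    by (auto simp: h_def stretched_kernel_def indicator_def less_le)
  have meas: "h \<in> borel_measurable borel" unfolding h_def[abs_def] by measurable
  have deriv: "(g has_field_derivative g' s) (at s)" if "s \<in> {0<..<t}" for s
    using that assms unfolding g_def g'_def
    by (auto intro!: derivative_eq_intros)
  have inj: "inj_on g {0<..<t}"
  proof (rule inj_onI)
    fix x y assume *: "x \<in> {0<..<t}" "y \<in> {0<..<t}" "g x = g y"
    then have "((x / t) powr k) powr (1 / k) = ((y / t) powr k) powr (1 / k)" by (simp add: g_def)
    then show "x = y" using k * by (simp add: powr_powr)
  qed
  have img: "g ` {0<..<t} = {0<..<1}"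
  proof (intro equalityI subsetI)
    fix y assume "y \<in> g ` {0<..<t}"
    then obtain x where x: "0 < x" "x < t" "y = (x / t) powr k" by (auto simp: g_def)
    then have "(x / t) powr k < 1 powr k" using k by (intro powr_less_mono2) auto
    then show "y \<in> {0<..<1}" using x by simp
  next
    fix y :: real assume y: "y \<in> {0<..<1}"
    have "y powr (1 / k) < 1 powr (1 / k)" using y k by (intro powr_less_mono2) auto
    then have "t * y powr (1 / k) \<in> {0<..<t}" using y assms by simp
    moreover have "g (t * y powr (1 / k)) = y" using y k assms by (simp add: g_def powr_powr)
    ultimately show "y \<in> g ` {0<..<t}" by force
  qed
  have eq: "h s = t powr (\<alpha> * (p + 1)) * (\<bar>g' s\<bar> * (g s powr (\<beta> * p + 1 - 1) * (1 - g s) powr (\<beta> - 1)))"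
    if s: "s \<in> {0<..<t}" for s
  proof -
    \<comment> \<open>In logarithms of s and t the identity between powers is a linear identity
      between exponents.\<close>
    define l where "l = ln s"
    define m where "m = ln t"
    have st: "s = exp l" "t = exp m" using s assms by (auto simp: l_def m_def)
    have gs: "0 < 1 - g s" using img s by force
    have "t powr k - s powr k = t powr k * (1 - g s)"
      using s assms by (simp add: g_def powr_divide right_diff_distrib)
    then have "h s = k * (s powr (k - 1) * (t powr k) powr (\<beta> - 1) * s powr (\<alpha> * p)) * (1 - g s) powr (\<beta> - 1)"
      using gs by (simp add: h_def stretched_kernel_def k_def[symmetric] powr_mult)
    moreover have "s powr (k - 1) * (t powr k) powr (\<beta> - 1) * s powr (\<alpha> * p)
        = t powr (\<alpha> * (p + 1)) * ((s / t) powr (k - 1) / t * g s powr (\<beta> * p))"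
      using assms unfolding g_def st
      by (simp add: powr_def exp_diff[symmetric] exp_add[symmetric] powr_powr ln_div)
         (simp add: k_def field_simps)
    moreover have "\<bar>g' s\<bar> = g' s"
      using s k assms by (simp add: g'_def)
    ultimately show ?thesis by (simp only:) (simp add: g'_def)
  qed
  have "0 < \<beta> * p + 1" using assms by (simp add: add_nonneg_pos)
  note B = Beta_substitution[OF _ deriv inj img this assms(2) meas eq, simplified]
  show "set_integrable lborel {0..t} (\<lambda>s. stretched_kernel \<alpha> \<beta> t s * s powr (\<alpha> * p))"
    using B(1) unfolding set_integrable_def ind[symmetric] by (simp add: h_def)
  show "(LINT s:{0..t}|lborel. stretched_kernel \<alpha> \<beta> t s * s powr (\<alpha> * p)) =
           t powr (\<alpha> * (p + 1)) * Beta (\<beta> * p + 1) \<beta>"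
    using B(2) unfolding set_lebesgue_integral_def ind[symmetric] by (simp add: h_def)
qed

lemma stretched_kernel_integrable:
  assumes "0 < \<alpha>" "0 < \<beta>" "0 < t"
  shows "set_integrable lborel {0..t} (stretched_kernel \<alpha> \<beta> t)"
proof -
  \<comment> \<open>At s = 0 the power with exponent 0 is 0 rather than 1, but the kernel is 0 there
    too.\<close>
  have "stretched_kernel \<alpha> \<beta> t s * s powr (\<alpha> * 0) = stretched_kernel \<alpha> \<beta> t s" for s
    by (cases "s = 0") (simp_all add: stretched_kernel_def)
  then show ?thesis using stretched_kernel_powr(1)[OF assms, of 0] by (simp only: order_refl)
qed

text \<open>The termwise Beta integral \<open>B(\<beta>n + 1, \<beta>) = \<Gamma>(\<beta>) \<Gamma>(\<beta>n + 1) / \<Gamma>(\<beta>(n + 1) + 1)\<close> shifts the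
  Mittag-Leffler series by one index.\<close>

lemma Mittag_Leffler_stretched_equation:
  assumes "0 < \<alpha>" "0 < \<beta>" "0 < t"
  shows "c * (LINT s:{0..t}|lborel. stretched_kernel \<alpha> \<beta> t s * Mittag_Leffler \<beta> (c * s powr \<alpha>))
    = Gamma \<beta> * (Mittag_Leffler \<beta> (c * t powr \<alpha>) - 1)"
proof -
  define G where "G n = Gamma (\<beta> * real n + 1)" for n
  have G: "0 < G n" for n unfolding G_def using assms by (intro Gamma_real_pos add_nonneg_pos) auto
  define k where "k n s = stretched_kernel \<alpha> \<beta> t s * s powr (\<alpha> * real n)" for n s
  have k: "set_integrable lborel {0..t} (k n)"
      "(LINT s:{0..t}|lborel. k n s) = t powr (\<alpha> * real (Suc n)) * (G n * Gamma \<beta> / G (Suc n))" for n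
  proof -
    have "Beta (\<beta> * real n + 1) \<beta> = G n * Gamma \<beta> / G (Suc n)"
      by (simp add: Beta_def G_def algebra_simps)
    then show "set_integrable lborel {0..t} (k n)"
        "(LINT s:{0..t}|lborel. k n s) = t powr (\<alpha> * real (Suc n)) * (G n * Gamma \<beta> / G (Suc n))"
      using stretched_kernel_powr[OF assms, of "real n"] unfolding k_def by (simp_all add: add_ac)
  qed
  define f where "f n s = indicator {0..t} s *\<^sub>R (c ^ n / G n * k n s)" for n s
  have fint: "integrable lborel (f n)" for n
    using set_integrable_mult_right[OF k(1), of "c ^ n / G n" n]
    by (simp add: f_def[abs_def] set_integrable_def)
  have powr: "s powr (\<alpha> * real n) = (s powr \<alpha>) ^ n" if "0 < s" for s n
    using that by (simp add: powr_powr[symmetric] powr_realpow)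
  have fsums: "(\<lambda>n. f n s) sums (indicator {0..t} s *\<^sub>R
      (stretched_kernel \<alpha> \<beta> t s * Mittag_Leffler \<beta> (c * s powr \<alpha>)))"
    and fabs: "summable (\<lambda>n. norm (f n s))" for s
  proof -
    have f: "f n s = indicator {0..t} s *\<^sub>R stretched_kernel \<alpha> \<beta> t s * ((c * s powr \<alpha>) ^ n / G n)" for n
    proof (cases "0 < s")
      case True
      then show ?thesis by (simp add: f_def k_def powr power_mult_distrib)
    next
      \<comment> \<open>At s = 0 and n = 0, \<open>s powr 0\<close> is 0 while
        \<open>(s powr \<alpha>) ^ 0\<close> is 1; the discrepancy is harmless because the kernel
        vanishes there. For negative s the indicator is 0.\<close>
      case False
      then have "indicator {0..t} s *\<^sub>R stretched_kernel \<alpha> \<beta> t s = 0"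
        by (cases "s = 0") (simp_all add: stretched_kernel_def)
      then show ?thesis by (auto simp: f_def k_def)
    qed
    show "(\<lambda>n. f n s) sums (indicator {0..t} s *\<^sub>R
      (stretched_kernel \<alpha> \<beta> t s * Mittag_Leffler \<beta> (c * s powr \<alpha>)))"
      unfolding f G_def 
      using sums_mult[OF Mittag_Leffler_sums[OF assms(2), of "c * s powr \<alpha>"],
          of "indicator {0..t} s *\<^sub>R stretched_kernel \<alpha> \<beta> t s"] by (simp add: mult.assoc)
    show "summable (\<lambda>n. norm (f n s))"
      unfolding f G_def real_norm_def abs_mult
      by (rule summable_mult[OF summable_Mittag_Leffler_abs[OF assms(2)]])
  qed
  have nint: "(LINT s|lborel. norm (f n s)) = Gamma \<beta> * t powr \<alpha> * \<bar>(c * t powr \<alpha>) ^ n / G (Suc n)\<bar>" for n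
  proof -
    have "norm (f n s) = \<bar>c ^ n\<bar> / G n * (indicator {0..t} s *\<^sub>R k n s)" for s
      using G[of n] stretched_kernel_nonneg[OF assms(1,2), of t s]
      by (auto simp: f_def k_def abs_mult indicator_def)
    then have "(LINT s|lborel. norm (f n s)) = \<bar>c ^ n\<bar> / G n * (LINT s:{0..t}|lborel. k n s)"
      by (simp add: set_lebesgue_integral_def)
    also have "\<dots> = Gamma \<beta> * t powr \<alpha> * \<bar>(c * t powr \<alpha>) ^ n / G (Suc n)\<bar>"
      using G[of n] G[of "Suc n"] assms
      by (simp add: k(2) powr[OF assms(3)] abs_mult power_mult_distrib distrib_left powr_add del: of_nat_Suc)
    finally show ?thesis .
  qed
  \<comment> \<open>The zeroth term is 1 / Gamma 1 = 1; its absence from the shifted series is the -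
    1 in the equation.\<close>
  have shift: "(\<lambda>n. x ^ Suc n / G (Suc n)) sums (Mittag_Leffler \<beta> x - 1)"
    and shift_abs: "summable (\<lambda>n. \<bar>x ^ Suc n / G (Suc n)\<bar>)" for x
  proof -
    show "(\<lambda>n. x ^ Suc n / G (Suc n)) sums (Mittag_Leffler \<beta> x - 1)"
      using Mittag_Leffler_sums[OF assms(2), of x] sums_Suc_iff[of "\<lambda>n. x ^ n / G n" "Mittag_Leffler \<beta> x - 1"]
      by (simp add: G_def)
    show "summable (\<lambda>n. \<bar>x ^ Suc n / G (Suc n)\<bar>)"
      using summable_Mittag_Leffler_abs[OF assms(2), of x] summable_Suc_iff[of "\<lambda>n. \<bar>x ^ n / G n\<bar>"]
      by (simp only: G_def)
  qed
  \<comment> \<open>The integrals contain \<open>G (Suc n)\<close> but only the n-th power of c.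
    Dividing by |c| turns them into terms of the shifted series, which is why c = 0 is treated
    apart.\<close>
  have sum_nint: "summable (\<lambda>n. LINT s|lborel. norm (f n s))"
  proof (cases "c = 0")
    case True
    show ?thesis unfolding nint by (rule summable_finite[of "{0}"]) (auto simp: True)
  next
    case False
    have "(LINT s|lborel. norm (f n s)) = Gamma \<beta> / \<bar>c\<bar> * \<bar>(c * t powr \<alpha>) ^ Suc n / G (Suc n)\<bar>" for n
      unfolding nint using False assms(3) by (simp add: abs_mult)
    then show ?thesis by (simp only: summable_mult[OF shift_abs])
  qed
  have "(\<lambda>n. LINT s|lborel. f n s) sums (LINT s|lborel. (\<Sum>n. f n s))"
    by (intro sums_integral fint AE_I2 fabs sum_nint)
  also have "(\<lambda>s. \<Sum>n. f n s) = (\<lambda>s. indicator {0..t} s *\<^sub>R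
      (stretched_kernel \<alpha> \<beta> t s * Mittag_Leffler \<beta> (c * s powr \<alpha>)))"
    using fsums by (simp add: sums_iff)
  finally have "(\<lambda>n. c * (LINT s|lborel. f n s)) sums
      (c * (LINT s:{0..t}|lborel. stretched_kernel \<alpha> \<beta> t s * Mittag_Leffler \<beta> (c * s powr \<alpha>)))"
    unfolding set_lebesgue_integral_def by (rule sums_mult)
  moreover have "c * (LINT s|lborel. f n s) = Gamma \<beta> * ((c * t powr \<alpha>) ^ Suc n / G (Suc n))" for n
  proof -
    have "(LINT s|lborel. f n s) = c ^ n / G n * (LINT s:{0..t}|lborel. k n s)"
      unfolding f_def set_lebesgue_integral_def integral_mult_right_zero[symmetric]
      by (intro Bochner_Integration.integral_cong) auto
    then show ?thesis
      using G[of n] G[of "Suc n"]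
      by (simp add: k(2) powr[OF assms(3)] power_mult_distrib del: of_nat_Suc)
  qed
  ultimately have "(\<lambda>n. Gamma \<beta> * ((c * t powr \<alpha>) ^ Suc n / G (Suc n))) sums
      (c * (LINT s:{0..t}|lborel. stretched_kernel \<alpha> \<beta> t s * Mittag_Leffler \<beta> (c * s powr \<alpha>)))"
    by simp
  then show ?thesis
    by (rule sums_unique2[OF _ sums_mult[OF shift]])
qed

section \<open>The integral of (1 - cos(t x)) |x|^(-1-\<alpha>)\<close>

lemma Gamma_reflection_real:
  fixes x :: real
  shows "Gamma x * Gamma (1 - x) = pi / sin (pi * x)"
proof -
  have "complex_of_real (Gamma x * Gamma (1 - x)) = Gamma (of_real x) * Gamma (1 - of_real x)"
    unfolding of_real_mult Gamma_complex_of_real[symmetric] by simp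
  also have "\<dots> = complex_of_real (pi / sin (pi * x))"
    by (simp add: Gamma_reflection_complex flip: sin_of_real)
  finally show ?thesis by (simp only: of_real_eq_iff)
qed

text \<open>With v = u^2 / (u^2 + t^2) this becomes half of t^a Beta(a/2, 1 - a/2), which the
  reflection formula evaluates. It serves twice: for the cosine integral, and for the integrability
  of the weight against 1 / (1 + x^2).\<close>

lemma powr_div_quadratic:
  assumes "0 < a" "a < 2" "0 < t"
  shows "set_integrable lborel {0<..} (\<lambda>u. u powr (a - 1) * t\<^sup>2 / (u\<^sup>2 + t\<^sup>2))"
    and "(LINT u:{0<..}|lborel. u powr (a - 1) * t\<^sup>2 / (u\<^sup>2 + t\<^sup>2)) =
           t powr a * (pi / (2 * sin (pi * a / 2)))"
proof -
  define g where "g u = u\<^sup>2 / (u\<^sup>2 + t\<^sup>2)" for u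
  define g' where "g' u = 2 * u * t\<^sup>2 / (u\<^sup>2 + t\<^sup>2)\<^sup>2" for u
  have D: "0 < u\<^sup>2 + t\<^sup>2" for u using assms by (intro add_nonneg_pos) auto
  have g1: "1 - g u = t\<^sup>2 / (u\<^sup>2 + t\<^sup>2)" for u
  proof -
    have "1 - g u = (u\<^sup>2 + t\<^sup>2 - u\<^sup>2) / (u\<^sup>2 + t\<^sup>2)"
      unfolding diff_divide_distrib g_def using assms by simp
    then show ?thesis by simp
  qed
  have deriv: "(g has_field_derivative g' u) (at u)" for u
    unfolding g_def g'_def using D[of u]
    by (auto intro!: derivative_eq_intros simp: power2_eq_square field_simps)
  have inj: "inj_on g {0<..}"
  proof (rule inj_onI)
    fix x y assume *: "x \<in> {0<..}" "y \<in> {0<..}" "g x = g y"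
    have "t\<^sup>2 / (x\<^sup>2 + t\<^sup>2) = t\<^sup>2 / (y\<^sup>2 + t\<^sup>2)" by (simp only: g1[symmetric] *(3))
    then have "x\<^sup>2 = y\<^sup>2" using D[of x] D[of y] assms by (simp add: field_simps)
    then show "x = y" using * by (simp add: power2_eq_iff)
  qed
  have img: "g ` {0<..} = {0<..<1}"
  proof (intro equalityI subsetI)
    fix v assume "v \<in> g ` {0<..}"
    then obtain u where u: "0 < u" "v = g u" by auto
    have "0 < g u" "0 < 1 - g u" unfolding g1 using u(1) D[of u] assms by (auto simp: g_def)
    then show "v \<in> {0<..<1}" using u by simp
  next
    fix v :: real assume v: "v \<in> {0<..<1}"
    have "(t * sqrt (v / (1 - v)))\<^sup>2 = t\<^sup>2 * v / (1 - v)"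
      using v by (simp add: power_mult_distrib)
    then have "g (t * sqrt (v / (1 - v))) = (t\<^sup>2 * v / (1 - v)) / (t\<^sup>2 * v / (1 - v) + t\<^sup>2)"
      by (simp add: g_def)
    also have "t\<^sup>2 * v / (1 - v) + t\<^sup>2 = t\<^sup>2 / (1 - v)"
      using v by (simp add: field_simps)
    finally have "g (t * sqrt (v / (1 - v))) = v" using v assms by simp
    moreover have "0 < t * sqrt (v / (1 - v))" using v assms by simp
    ultimately show "v \<in> g ` {0<..}" by force
  qed
  have eq: "u powr (a - 1) * t\<^sup>2 / (u\<^sup>2 + t\<^sup>2) =
      t powr a / 2 * (\<bar>g' u\<bar> * (g u powr (a / 2 - 1) * (1 - g u) powr (1 - a / 2 - 1)))"
    if u: "u \<in> {0<..}" for u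
  proof -
    define d where "d = u\<^sup>2 + t\<^sup>2"
    have d: "0 < d" using D by (simp add: d_def)
    have sq: "(u\<^sup>2) powr c = u powr (2 * c)" "(t\<^sup>2) powr c = t powr (2 * c)" for c
      using powr_powr[of u 2 c] powr_powr[of t 2 c] u assms by simp_all
    have "g u powr (a / 2 - 1) * (1 - g u) powr (1 - a / 2 - 1)
        = u powr (a - 2) / d powr (a / 2 - 1) * (t powr (- a) / d powr (- (a / 2)))"
      unfolding g1 unfolding g_def d_def[symmetric] using u d assms
      by (simp add: powr_divide sq right_diff_distrib)
    also have "\<dots> = u powr (a - 2) * t powr (- a) * d"
    proof -
      have "d powr (a / 2 - 1) * d powr (- (a / 2)) = 1 / d"
        using d powr_add[of d "a / 2 - 1" "- (a / 2)"] by (simp add: powr_minus_divide)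
      then show ?thesis by simp
    qed
    also have "t powr a / 2 * (\<bar>g' u\<bar> * \<dots>) = t powr a * t powr (- a) * (u * u powr (a - 2)) * t\<^sup>2 / d"
    proof -
      have "\<bar>g' u\<bar> = 2 * u * t\<^sup>2 / (d * d)"
        unfolding g'_def d_def using u by (simp add: power2_eq_square)
      then show ?thesis using d by simp
    qed
    also have "t powr a * t powr (- a) = 1" using assms by (simp flip: powr_add)
    also have "u * u powr (a - 2) = u powr (a - 1)" using u by (simp add: powr_mult_base)
    finally show ?thesis unfolding d_def mult_1 by (rule sym)
  qed
  have ab: "0 < a / 2" "0 < 1 - a / 2" using assms by auto
  have meas: "(\<lambda>u. u powr (a - 1) * t\<^sup>2 / (u\<^sup>2 + t\<^sup>2)) \<in> borel_measurable borel"
    by measurable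
  have S: "{0::real<..} \<in> sets borel" by simp
  show "set_integrable lborel {0<..} (\<lambda>u. u powr (a - 1) * t\<^sup>2 / (u\<^sup>2 + t\<^sup>2))"
    using S deriv inj img ab meas eq by (rule Beta_substitution(1))
  have "(LINT u:{0<..}|lborel. u powr (a - 1) * t\<^sup>2 / (u\<^sup>2 + t\<^sup>2)) = t powr a / 2 * Beta (a / 2) (1 - a / 2)"
    using S deriv inj img ab meas eq by (rule Beta_substitution(2))
  also have "Beta (a / 2) (1 - a / 2) = pi / sin (pi * a / 2)"
    using Gamma_reflection_real[of "a / 2"] by (simp add: Beta_def)
  finally show "(LINT u:{0<..}|lborel. u powr (a - 1) * t\<^sup>2 / (u\<^sup>2 + t\<^sup>2)) =
           t powr a * (pi / (2 * sin (pi * a / 2)))"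
    by simp
qed

text \<open>The Gamma integral rescaled by x. It is stated in \<open>ennreal\<close> so that the
  later exchange of integrals needs measurability only.\<close>

lemma nn_integral_powr_exp:
  fixes x s :: real
  assumes "0 < x" "0 < s"
  shows "(\<integral>\<^sup>+u. ennreal (u powr (s - 1) * exp (- (u * x))) * indicator {0<..} u \<partial>lborel)
    = ennreal (Gamma s * x powr (- s))"
proof -
  let ?I = "\<integral>\<^sup>+u. ennreal (u powr (s - 1) * exp (- (u * x))) * indicator {0<..} u \<partial>lborel"
  have "ennreal (Gamma s) = (\<integral>\<^sup>+t. ennreal (indicator {0..} t * t powr (s - 1) / exp t) \<partial>lborel)"
    using assms by (simp add: Gamma_conv_nn_integral_real)
  also have "\<dots> = ennreal x * (\<integral>\<^sup>+u. ennreal (indicator {0..} (x * u) * (x * u) powr (s - 1) / exp (x * u)) \<partial>lborel)"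
    using assms by (subst nn_integral_real_affine[where c = x and t = 0]) auto
  also have "(\<integral>\<^sup>+u. ennreal (indicator {0..} (x * u) * (x * u) powr (s - 1) / exp (x * u)) \<partial>lborel)
      = (\<integral>\<^sup>+u. ennreal (x powr (s - 1)) * (ennreal (u powr (s - 1) * exp (- (u * x))) * indicator {0<..} u) \<partial>lborel)"
    using assms
    by (intro nn_integral_cong)
      (auto simp: indicator_def zero_le_mult_iff zero_less_mult_iff powr_mult exp_minus field_simps le_less simp flip: ennreal_mult)
  also have "\<dots> = ennreal (x powr (s - 1)) * ?I"
    by (intro nn_integral_cmult) auto
  also have "ennreal x * (ennreal (x powr (s - 1)) * ?I) = ennreal (x powr s) * ?I"
  proof -
    have "ennreal x * ennreal (x powr (s - 1)) = ennreal (x powr s)"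
      using assms by (simp add: powr_mult_base flip: ennreal_mult)
    then show ?thesis by (simp only: mult.assoc[symmetric])
  qed
  finally have "ennreal (x powr (- s)) * ennreal (Gamma s) = ennreal (x powr (- s)) * (ennreal (x powr s) * ?I)"
    by simp
  also have "\<dots> = ?I"
  proof -
    have "ennreal (x powr (- s)) * ennreal (x powr s) = 1"
      using assms by (simp flip: ennreal_mult powr_add)
    then show ?thesis by (simp only: mult.assoc[symmetric] mult_1)
  qed
  finally show ?thesis
    using assms by (simp add: mult.commute flip: ennreal_mult)
qed

lemma nn_integral_one_minus_cos_exp:
  fixes t u :: real
  assumes "0 < u"
  shows "(\<integral>\<^sup>+x. ennreal ((1 - cos (t * x)) * exp (- (u * x))) * indicator {0<..} x \<partial>lborel)
    = ennreal (t\<^sup>2 / (u * (u\<^sup>2 + t\<^sup>2)))"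
proof -
  define D where "D = u\<^sup>2 + t\<^sup>2"
  have D: "0 < D" using assms by (simp add: D_def add_pos_nonneg)
  \<comment> \<open>The antiderivatives of exp(- u x) and exp(- u x) cos(t x), both normalised to
    vanish at infinity. The integral is therefore - F 0 = 1 / u - u / D = t^2 / (u D).\<close>
  define F where "F x = - exp (- (u * x)) * (1 / u + (t * sin (t * x) - u * cos (t * x)) / D)" for x
  have F: "(F has_field_derivative (1 - cos (t * x)) * exp (- (u * x))) (at x)" for x
  proof -
    have "(F has_field_derivative (u * exp (- (u * x)) * (1 / u + (t * sin (t * x) - u * cos (t * x)) / D)
        - exp (- (u * x)) * (t * (t * cos (t * x)) + u * (t * sin (t * x))) / D)) (at x)"
      unfolding F_def using D by (auto intro!: derivative_eq_intros simp: field_simps)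
    moreover have "u * exp (- (u * x)) * (1 / u + (t * sin (t * x) - u * cos (t * x)) / D)
        - exp (- (u * x)) * (t * (t * cos (t * x)) + u * (t * sin (t * x))) / D
        = exp (- (u * x)) * (1 - cos (t * x) * (u\<^sup>2 + t\<^sup>2) / D)"
      using assms D by (simp add: field_simps power2_eq_square)
    ultimately show ?thesis using D by (simp add: D_def[symmetric] mult.commute)
  qed
  have bound: "\<bar>F x\<bar> \<le> (1 / u + (\<bar>t\<bar> + u) / D) * exp (- (u * x))" for x
  proof -
    have "\<bar>t * sin (t * x) - u * cos (t * x)\<bar> \<le> \<bar>t\<bar> * 1 + u * 1"
      using assms by (intro order_trans[OF abs_triangle_ineq4] add_mono)
        (auto simp: abs_mult intro!: mult_left_le)
    then have "\<bar>1 / u + (t * sin (t * x) - u * cos (t * x)) / D\<bar> \<le> 1 / u + (\<bar>t\<bar> + u) / D"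
      using D assms by (intro order_trans[OF abs_triangle_ineq] add_mono) (auto simp: divide_right_mono)
    then show ?thesis by (simp add: F_def abs_mult mult.commute)
  qed
  have bound_lim: "((\<lambda>x. (1 / u + (\<bar>t\<bar> + u) / D) * exp (- (u * x))) \<longlongrightarrow> 0) at_top"
  proof (rule tendsto_mult_right_zero, rule filterlim_compose[OF exp_at_bot])
    show "filterlim (\<lambda>x. - (u * x)) at_bot at_top"
      using assms by (auto simp: filterlim_uminus_at_bot intro!: filterlim_tendsto_pos_mult_at_top[OF tendsto_const] filterlim_ident)
  qed
  have "\<forall>\<^sub>F x in at_top. norm (F x) \<le> (1 / u + (\<bar>t\<bar> + u) / D) * exp (- (u * x))"
    using bound by (intro always_eventually) simp
  then have lim: "(F \<longlongrightarrow> 0) at_top"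
    by (rule Lim_null_comparison[OF _ bound_lim])
  have "(\<integral>\<^sup>+x. ennreal ((1 - cos (t * x)) * exp (- (u * x))) * indicator {0<..} x \<partial>lborel)
      = (\<integral>\<^sup>+x. ennreal ((1 - cos (t * x)) * exp (- (u * x))) * indicator {0..} x \<partial>lborel)"
    by (intro nn_integral_cong) (auto simp: indicator_def)
  also have "\<dots> = ennreal (0 - F 0)"
    by (rule nn_integral_FTC_atLeast[OF _ F _ lim]) auto
  also have "0 - F 0 = t\<^sup>2 / (u * D)"
    using assms D by (simp add: F_def field_simps) (simp add: D_def power2_eq_square algebra_simps)
  finally show ?thesis by (simp add: D_def)
qed

lemma nn_integral_even:
  fixes f :: "real \<Rightarrow> ennreal"
  assumes [measurable]: "f \<in> borel_measurable borel"
  shows "(\<integral>\<^sup>+x. f \<bar>x\<bar> \<partial>lborel) = 2 * (\<integral>\<^sup>+x. f x * indicator {0<..} x \<partial>lborel)"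
proof -
  have "AE x in lborel. x \<noteq> (0::real)" by (rule AE_lborel_singleton)
  then have "(\<integral>\<^sup>+x. f \<bar>x\<bar> \<partial>lborel) = (\<integral>\<^sup>+x. f x * indicator {0<..} x + f (- x) * indicator {0<..} (- x) \<partial>lborel)"
    by (intro nn_integral_cong_AE) (auto simp: indicator_def abs_if elim!: eventually_mono)
  also have "\<dots> = (\<integral>\<^sup>+x. f x * indicator {0<..} x \<partial>lborel) + (\<integral>\<^sup>+x. f (- x) * indicator {0<..} (- x) \<partial>lborel)"
    by (intro nn_integral_add) auto
  also have "(\<integral>\<^sup>+x. f (- x) * indicator {0<..} (- x) \<partial>lborel) = (\<integral>\<^sup>+x. f x * indicator {0<..} x \<partial>lborel)"
    by (subst (2) nn_integral_real_affine[where c = "-1" and t = 0]) auto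
  finally show ?thesis by (simp add: mult_2)
qed

text \<open>Writing \<open>\<Gamma>(\<alpha> + 1) x\<^bsup>-1-\<alpha>\<^esup>\<close> as a Laplace integral turns this into a Beta integral.\<close>

lemma nn_integral_one_minus_cos_powr:
  assumes "0 < \<alpha>" "\<alpha> < 2" "0 < t"
  shows "(\<integral>\<^sup>+x. ennreal ((1 - cos (t * x)) * x powr (- 1 - \<alpha>)) * indicator {0<..} x \<partial>lborel)
    = ennreal (t powr \<alpha> * (pi / (2 * C_const \<alpha>)))"
proof -
  let ?I = "\<integral>\<^sup>+x. ennreal ((1 - cos (t * x)) * x powr (- 1 - \<alpha>)) * indicator {0<..} x \<partial>lborel"
  have G: "0 < Gamma (\<alpha> + 1)" using assms by (intro Gamma_real_pos) auto
  have sin: "0 < sin (pi * \<alpha> / 2)" using assms by (intro sin_gt_zero) auto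
  let ?f = "\<lambda>x u. ennreal ((1 - cos (t * x)) * (u powr \<alpha> * exp (- (u * x)))) *
      indicator {0<..} x * indicator {0<..} u"
  have "ennreal (Gamma (\<alpha> + 1)) * ?I =
      (\<integral>\<^sup>+x. ennreal (Gamma (\<alpha> + 1)) * (ennreal ((1 - cos (t * x)) * x powr (- 1 - \<alpha>)) * indicator {0<..} x) \<partial>lborel)"
    by (intro nn_integral_cmult[symmetric]) auto
  also have "\<dots> = (\<integral>\<^sup>+x. (\<integral>\<^sup>+u. ?f x u \<partial>lborel) \<partial>lborel)"
  proof (intro nn_integral_cong)
    fix x :: real
    show "ennreal (Gamma (\<alpha> + 1)) * (ennreal ((1 - cos (t * x)) * x powr (- 1 - \<alpha>)) * indicator {0<..} x)
        = (\<integral>\<^sup>+u. ?f x u \<partial>lborel)"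
    proof (cases "0 < x")
      case True
      have "(\<integral>\<^sup>+u. ?f x u \<partial>lborel) = (\<integral>\<^sup>+u. ennreal (1 - cos (t * x)) *
          (ennreal (u powr \<alpha> * exp (- (u * x))) * indicator {0<..} u) \<partial>lborel)"
        using True by (intro nn_integral_cong) (simp add: ennreal_mult mult.assoc)
      also have "\<dots> = ennreal (1 - cos (t * x)) * ennreal (Gamma (\<alpha> + 1) * x powr (- 1 - \<alpha>))"
        using True assms by (subst nn_integral_cmult) (simp_all add: nn_integral_powr_exp[of x "\<alpha> + 1", simplified] minus_diff_commute)
      also have "\<dots> = ennreal (Gamma (\<alpha> + 1)) * (ennreal ((1 - cos (t * x)) * x powr (- 1 - \<alpha>)) * indicator {0<..} x)"
        using True G by (simp add: mult_ac flip: ennreal_mult)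
      finally show ?thesis by simp
    qed simp
  qed
  \<comment> \<open>Tonelli for a nonnegative integrand; in this order the x-integral is elementary
    and leaves u^\<alpha> t^2 / (u (u^2 + t^2)).\<close>
  also have "\<dots> = (\<integral>\<^sup>+u. (\<integral>\<^sup>+x. ?f x u \<partial>lborel) \<partial>lborel)"
    by (rule lborel_pair.Fubini'[symmetric]) measurable
  also have "\<dots> = (\<integral>\<^sup>+u. ennreal (indicator {0<..} u *\<^sub>R (u powr (\<alpha> - 1) * t\<^sup>2 / (u\<^sup>2 + t\<^sup>2))) \<partial>lborel)"
  proof (intro nn_integral_cong)
    fix u :: real
    show "(\<integral>\<^sup>+x. ?f x u \<partial>lborel) = ennreal (indicator {0<..} u *\<^sub>R (u powr (\<alpha> - 1) * t\<^sup>2 / (u\<^sup>2 + t\<^sup>2)))"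
    proof (cases "0 < u")
      case True
      have "(\<integral>\<^sup>+x. ?f x u \<partial>lborel) = (\<integral>\<^sup>+x. ennreal (u powr \<alpha>) *
          (ennreal ((1 - cos (t * x)) * exp (- (u * x))) * indicator {0<..} x) \<partial>lborel)"
        using True by (intro nn_integral_cong) (simp add: ennreal_mult mult_ac)
      also have "\<dots> = ennreal (u powr \<alpha>) * ennreal (t\<^sup>2 / (u * (u\<^sup>2 + t\<^sup>2)))"
        using True by (subst nn_integral_cmult) (auto simp: nn_integral_one_minus_cos_exp)
      also have "\<dots> = ennreal (u powr \<alpha> * (t\<^sup>2 / (u * (u\<^sup>2 + t\<^sup>2))))"
        using True by (simp flip: ennreal_mult)
      also have "u powr \<alpha> * (t\<^sup>2 / (u * (u\<^sup>2 + t\<^sup>2))) = u powr (\<alpha> - 1) * t\<^sup>2 / (u\<^sup>2 + t\<^sup>2)"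
        using True by (simp add: powr_diff)
      finally show ?thesis using True by simp
    qed simp
  qed
  also have "\<dots> = ennreal (t powr \<alpha> * (pi / (2 * sin (pi * \<alpha> / 2))))"
    using powr_div_quadratic[OF assms] unfolding set_integrable_def set_lebesgue_integral_def
    by (subst nn_integral_eq_integral) (auto simp: indicator_def)
  \<comment> \<open>Dividing by Gamma(\<alpha> + 1) puts it beside sin(pi \<alpha> / 2) in the
    denominator: their product is \<open>C_const\<close>.\<close>
  finally have "ennreal (1 / Gamma (\<alpha> + 1)) * (ennreal (Gamma (\<alpha> + 1)) * ?I)
      = ennreal (1 / Gamma (\<alpha> + 1)) * ennreal (t powr \<alpha> * (pi / (2 * sin (pi * \<alpha> / 2))))"
    by simp
  moreover have "ennreal (1 / Gamma (\<alpha> + 1)) * (ennreal (Gamma (\<alpha> + 1)) * ?I) = ?I"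
  proof -
    have "ennreal (1 / Gamma (\<alpha> + 1)) * ennreal (Gamma (\<alpha> + 1)) = 1"
      using G by (simp flip: ennreal_mult)
    then show ?thesis by (simp only: mult.assoc[symmetric] mult_1)
  qed
  ultimately show ?thesis
    using G sin by (simp add: C_const_def mult_ac flip: ennreal_mult)
qed

lemma C_const_pos: "0 < \<alpha> \<Longrightarrow> \<alpha> < 2 \<Longrightarrow> 0 < C_const \<alpha>"
  unfolding C_const_def by (intro mult_pos_pos Gamma_real_pos sin_gt_zero) auto

lemma has_bochner_integral_one_minus_cos:
  assumes "0 < \<alpha>" "\<alpha> < 2" "0 < t"
  shows "has_bochner_integral lborel (\<lambda>x. (1 - cos (t * x)) * \<bar>x\<bar> powr (- 1 - \<alpha>))
    (t powr \<alpha> * (pi / C_const \<alpha>))"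
proof (rule has_bochner_integral_nn_integral)
  have cos: "cos (t * \<bar>x\<bar>) = cos (t * x)" for x by (simp add: abs_if)
  have "(\<integral>\<^sup>+x. ennreal ((1 - cos (t * x)) * \<bar>x\<bar> powr (- 1 - \<alpha>)) \<partial>lborel)
      = 2 * (\<integral>\<^sup>+x. ennreal ((1 - cos (t * x)) * x powr (- 1 - \<alpha>)) * indicator {0<..} x \<partial>lborel)"
    using nn_integral_even[of "\<lambda>x. ennreal ((1 - cos (t * x)) * x powr (- 1 - \<alpha>))"] by (simp add: cos)
  also have "\<dots> = ennreal 2 * ennreal (t powr \<alpha> * (pi / (2 * C_const \<alpha>)))"
    by (simp add: nn_integral_one_minus_cos_powr[OF assms])
  also have "\<dots> = ennreal (t powr \<alpha> * (pi / C_const \<alpha>))"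
    using C_const_pos[OF assms(1,2)] by (subst ennreal_mult[symmetric]) auto
  finally show "(\<integral>\<^sup>+x. ennreal ((1 - cos (t * x)) * \<bar>x\<bar> powr (- 1 - \<alpha>)) \<partial>lborel)
      = ennreal (t powr \<alpha> * (pi / C_const \<alpha>))" .
qed (use C_const_pos[OF assms(1,2)] in auto)

text \<open>With a = 2 - \<alpha> the numerator is the weight |x|^(1-\<alpha>): \<alpha> < 2
  controls its singularity at 0 and \<alpha> > 0 its growth at infinity.\<close>

lemma integrable_powr_div_quadratic:
  assumes "0 < a" "a < 2"
  shows "integrable lborel (\<lambda>x::real. \<bar>x\<bar> powr (a - 1) / (1 + x\<^sup>2))"
proof (rule integrableI_nonneg)
  have "(\<integral>\<^sup>+x. ennreal (\<bar>x\<bar> powr (a - 1) / (1 + x\<^sup>2)) \<partial>lborel)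
      = 2 * (\<integral>\<^sup>+x. ennreal (x powr (a - 1) / (1 + x\<^sup>2)) * indicator {0<..} x \<partial>lborel)"
    using nn_integral_even[of "\<lambda>x. ennreal (x powr (a - 1) / (1 + x\<^sup>2))"] by simp
  also have "(\<integral>\<^sup>+x. ennreal (x powr (a - 1) / (1 + x\<^sup>2)) * indicator {0<..} x \<partial>lborel)
      = (\<integral>\<^sup>+x. ennreal (indicator {0<..} x *\<^sub>R (x powr (a - 1) * 1\<^sup>2 / (x\<^sup>2 + 1\<^sup>2))) \<partial>lborel)"
    by (intro nn_integral_cong) (auto simp: indicator_def add.commute)
  also have "2 * \<dots> < \<infinity>"
    using powr_div_quadratic(1)[OF assms, of 1] unfolding set_integrable_def
    by (subst nn_integral_eq_integral) (auto simp: indicator_def ennreal_mult_less_top)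
  finally show "(\<integral>\<^sup>+x. ennreal (\<bar>x\<bar> powr (a - 1) / (1 + x\<^sup>2)) \<partial>lborel) < \<infinity>"
    by simp
qed auto

section \<open>The completion of the Schwartz space\<close>

lemma schwartz_space_of_real:
  fixes f :: "real \<Rightarrow> real"
  shows "f \<in> schwartz_space \<Longrightarrow> (\<lambda>x. complex_of_real (f x)) \<in> schwartz_space"
  by (rule schwartz_space_bounded_linear[OF bounded_linear_of_real])

lemma fourier_measurable [measurable]:
  assumes [measurable]: "f \<in> borel_measurable borel"
  shows "fourier f \<in> borel_measurable borel"
  unfolding fourier_def[abs_def] by measurable

lemma fourier_add:
  "integrable lborel f \<Longrightarrow> integrable lborel g \<Longrightarrow> fourier (\<lambda>y. f y + g y) x = fourier f x + fourier g x"
  unfolding fourier_def by (simp add: distrib_left integrable_cis_mult)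

lemma fourier_minus: "fourier (\<lambda>y. - f y) x = - fourier f x"
  by (simp add: fourier_def)

text \<open>The integrability conditions of \<open>S0_embed\<close>, isolated because the transform
  is additive only on integrable functions and a divergent weighted integral would give
  \<open>alpha_norm\<close> the value 0.\<close>

definition alpha_finite :: "real \<Rightarrow> (real \<Rightarrow> real) \<Rightarrow> bool" where
  "alpha_finite \<alpha> f \<longleftrightarrow> integrable lborel f \<and>
     integrable lborel (\<lambda>x. (cmod (fourier (\<lambda>y. complex_of_real (f y)) x))\<^sup>2 * \<bar>x\<bar> powr (1 - \<alpha>))"

lemma alpha_norm_eq:
  "alpha_norm \<alpha> f = sqrt (C_const \<alpha> *
     (LINT x|lborel. (cmod (fourier (\<lambda>y. complex_of_real (f y)) x))\<^sup>2 * \<bar>x\<bar> powr (1 - \<alpha>)))"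
proof -
  have *: "cnj z * z * complex_of_real r = complex_of_real ((cmod z)\<^sup>2 * r)" for z r
    by (metis complex_norm_square mult.commute of_real_mult)
  have "alpha_inner \<alpha> f f = complex_of_real (C_const \<alpha> *
     (LINT x|lborel. (cmod (fourier (\<lambda>y. complex_of_real (f y)) x))\<^sup>2 * \<bar>x\<bar> powr (1 - \<alpha>)))"
    unfolding alpha_inner_def * integral_complex_of_real of_real_mult[of "C_const \<alpha>"] by (rule refl)
  then show ?thesis by (simp add: alpha_norm_def)
qed

lemma LIMSEQ_zero_squeeze:
  fixes f a b :: "nat \<Rightarrow> real"
  assumes "\<And>n. 0 \<le> f n" "\<And>n. f n \<le> 2 * (a n + b n)" "a \<longlonglongrightarrow> 0" "b \<longlonglongrightarrow> 0"
  shows "f \<longlonglongrightarrow> 0"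
proof (rule Lim_null_comparison)
  show "\<forall>\<^sub>F n in sequentially. norm (f n) \<le> 2 * (a n + b n)"
    using assms(1,2) by (intro always_eventually) simp
  show "(\<lambda>n. 2 * (a n + b n)) \<longlonglongrightarrow> 0"
    using tendsto_mult[OF tendsto_const[of 2] tendsto_add[OF assms(3,4)]] by simp
qed

context
  fixes \<alpha> :: real
  assumes \<alpha>: "0 < \<alpha>" "\<alpha> < 2"
begin

lemma alpha_norm_nonneg: "0 \<le> alpha_norm \<alpha> f"
  unfolding alpha_norm_eq
  using C_const_pos[OF \<alpha>] by (intro real_sqrt_ge_zero mult_nonneg_nonneg integral_nonneg) auto

lemma alpha_norm_sq:
  "(alpha_norm \<alpha> f)\<^sup>2 = C_const \<alpha> *
     (LINT x|lborel. (cmod (fourier (\<lambda>y. complex_of_real (f y)) x))\<^sup>2 * \<bar>x\<bar> powr (1 - \<alpha>))"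
  unfolding alpha_norm_eq
  using C_const_pos[OF \<alpha>] by (intro real_sqrt_pow2 mult_nonneg_nonneg integral_nonneg) auto

lemma alpha_norm_minus: "alpha_norm \<alpha> (\<lambda>x. - f x) = alpha_norm \<alpha> f"
  by (simp add: alpha_norm_eq fourier_minus)

lemma alpha_finite_minus: "alpha_finite \<alpha> f \<Longrightarrow> alpha_finite \<alpha> (\<lambda>x. - f x)"
  by (simp add: alpha_finite_def fourier_minus)

text \<open>Pointwise, |z + w|^2 \<le> 2 |z|^2 + 2 |w|^2. Integrating against the weight bounds the
  squared norm by 2 a^2 + 2 b^2 \<le> (2 (a + b))^2, which avoids a Cauchy-Schwarz inequality for
  the weighted integral.\<close>

lemma
  assumes f: "alpha_finite \<alpha> f" and g: "alpha_finite \<alpha> g"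
  shows alpha_finite_add: "alpha_finite \<alpha> (\<lambda>x. f x + g x)"
    and alpha_norm_add: "alpha_norm \<alpha> (\<lambda>x. f x + g x) \<le> 2 * (alpha_norm \<alpha> f + alpha_norm \<alpha> g)"
proof -
  define F where "F = fourier (\<lambda>y. complex_of_real (f y))"
  define G where "G = fourier (\<lambda>y. complex_of_real (g y))"
  define w where "w x = \<bar>x\<bar> powr (1 - \<alpha>)" for x
  have int: "integrable lborel f" "integrable lborel g"
      "integrable lborel (\<lambda>x. (cmod (F x))\<^sup>2 * w x)" "integrable lborel (\<lambda>x. (cmod (G x))\<^sup>2 * w x)"
    using f g by (auto simp: alpha_finite_def F_def G_def w_def)
  have [measurable]: "f \<in> borel_measurable borel" "g \<in> borel_measurable borel" "w \<in> borel_measurable borel"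
    using int unfolding w_def by auto
  have [measurable]: "F \<in> borel_measurable borel" "G \<in> borel_measurable borel"
    unfolding F_def G_def by measurable
  have FG: "fourier (\<lambda>y. complex_of_real (f y + g y)) x = F x + G x" for x
    using int by (simp add: F_def G_def fourier_add)
  have le: "(cmod (F x + G x))\<^sup>2 * w x \<le> 2 * ((cmod (F x))\<^sup>2 * w x) + 2 * ((cmod (G x))\<^sup>2 * w x)" for x
  proof -
    have "(cmod (F x + G x))\<^sup>2 \<le> (cmod (F x) + cmod (G x))\<^sup>2"
      by (intro power_mono norm_triangle_ineq) auto
    also have "\<dots> \<le> 2 * (cmod (F x))\<^sup>2 + 2 * (cmod (G x))\<^sup>2"
      using zero_le_power2[of "cmod (F x) - cmod (G x)"] by (simp add: power2_diff power2_sum)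
    finally have "(cmod (F x + G x))\<^sup>2 * w x \<le> (2 * (cmod (F x))\<^sup>2 + 2 * (cmod (G x))\<^sup>2) * w x"
      by (intro mult_right_mono) (auto simp: w_def)
    then show ?thesis by (simp add: algebra_simps)
  qed
  have int2: "integrable lborel (\<lambda>x. 2 * ((cmod (F x))\<^sup>2 * w x) + 2 * ((cmod (G x))\<^sup>2 * w x))"
    using int by auto
  have sum: "integrable lborel (\<lambda>x. (cmod (F x + G x))\<^sup>2 * w x)"
  proof (rule Bochner_Integration.integrable_bound[OF int2])
    show "AE x in lborel. norm ((cmod (F x + G x))\<^sup>2 * w x)
        \<le> norm (2 * ((cmod (F x))\<^sup>2 * w x) + 2 * ((cmod (G x))\<^sup>2 * w x))"
    proof (intro AE_I2)
      fix x
      have "0 \<le> (cmod (F x + G x))\<^sup>2 * w x" by (simp add: w_def)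
      then show "norm ((cmod (F x + G x))\<^sup>2 * w x)
          \<le> norm (2 * ((cmod (F x))\<^sup>2 * w x) + 2 * ((cmod (G x))\<^sup>2 * w x))"
        using le[of x] by (simp only: real_norm_def)
    qed
  qed measurable
  then show "alpha_finite \<alpha> (\<lambda>x. f x + g x)"
    using int unfolding alpha_finite_def FG w_def by auto
  have "(LINT x|lborel. (cmod (F x + G x))\<^sup>2 * w x)
      \<le> (LINT x|lborel. 2 * ((cmod (F x))\<^sup>2 * w x) + 2 * ((cmod (G x))\<^sup>2 * w x))"
    by (intro integral_mono sum int2 le)
  also have "\<dots> = 2 * (LINT x|lborel. (cmod (F x))\<^sup>2 * w x) + 2 * (LINT x|lborel. (cmod (G x))\<^sup>2 * w x)"
    using int by simp
  finally have le_int: "(LINT x|lborel. (cmod (F x + G x))\<^sup>2 * w x)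
      \<le> 2 * (LINT x|lborel. (cmod (F x))\<^sup>2 * w x) + 2 * (LINT x|lborel. (cmod (G x))\<^sup>2 * w x)" .
  have "(alpha_norm \<alpha> (\<lambda>x. f x + g x))\<^sup>2 \<le> 2 * (alpha_norm \<alpha> f)\<^sup>2 + 2 * (alpha_norm \<alpha> g)\<^sup>2"
    unfolding alpha_norm_sq FG F_def[symmetric] G_def[symmetric] w_def[symmetric]
    using mult_left_mono[OF le_int, of "C_const \<alpha>"] C_const_pos[OF \<alpha>]
    by (simp add: distrib_left mult.left_commute)
  also have "\<dots> \<le> (2 * (alpha_norm \<alpha> f + alpha_norm \<alpha> g))\<^sup>2"
    using alpha_norm_nonneg[of f] alpha_norm_nonneg[of g] by (simp add: power2_sum power_mult_distrib)
  finally show "alpha_norm \<alpha> (\<lambda>x. f x + g x) \<le> 2 * (alpha_norm \<alpha> f + alpha_norm \<alpha> g)"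
    using alpha_norm_nonneg by (intro power2_le_imp_le[of "alpha_norm \<alpha> (\<lambda>x. f x + g x)"]) auto
qed

lemma alpha_finite_diff:
  "alpha_finite \<alpha> f \<Longrightarrow> alpha_finite \<alpha> g \<Longrightarrow> alpha_finite \<alpha> (\<lambda>x. f x - g x)"
  using alpha_finite_add[of f "\<lambda>x. - g x"] alpha_finite_minus[of g] by simp

lemma alpha_norm_diff_commute: "alpha_norm \<alpha> (\<lambda>x. f x - g x) = alpha_norm \<alpha> (\<lambda>x. g x - f x)"
  using alpha_norm_minus[of "\<lambda>x. f x - g x"] by simp

lemma alpha_norm_triangle:
  assumes "alpha_finite \<alpha> f" "alpha_finite \<alpha> g" "alpha_finite \<alpha> h"
  shows "alpha_norm \<alpha> (\<lambda>x. f x - h x) \<le>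
    2 * (alpha_norm \<alpha> (\<lambda>x. f x - g x) + alpha_norm \<alpha> (\<lambda>x. g x - h x))"
  using alpha_norm_add[OF alpha_finite_diff[OF assms(1,2)] alpha_finite_diff[OF assms(2,3)]] by simp

text \<open>Boundedness of F and of x F gives |F|^2 \<le> (A^2 + B^2) / (1 + x^2), and against this
  the weight is integrable.\<close>

lemma alpha_finite_schwartz:
  assumes "f \<in> schwartz_space"
  shows "alpha_finite \<alpha> f"
proof -
  define F where "F = fourier (\<lambda>y. complex_of_real (f y))"
  have F: "F \<in> schwartz_space"
    unfolding F_def by (intro fourier_schwartz_space schwartz_space_of_real assms)
  have [measurable]: "F \<in> borel_measurable borel"
    by (intro borel_measurable_continuous_onI schwartz_space_continuous_on F)
  obtain A where A: "\<And>x. \<bar>x\<bar> ^ 0 * cmod (F x) \<le> A" using schwartz_space_bound[OF F] by blast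
  obtain B where B: "\<And>x. \<bar>x\<bar> ^ 1 * cmod (F x) \<le> B" using schwartz_space_bound[OF F] by blast
  have le: "(cmod (F x))\<^sup>2 * \<bar>x\<bar> powr (1 - \<alpha>) \<le> (A\<^sup>2 + B\<^sup>2) * (\<bar>x\<bar> powr (2 - \<alpha> - 1) / (1 + x\<^sup>2))" for x
  proof -
    have "(cmod (F x))\<^sup>2 \<le> A\<^sup>2" using A[of x] by (intro power_mono) auto
    moreover have "(\<bar>x\<bar> * cmod (F x))\<^sup>2 \<le> B\<^sup>2" using B[of x] by (intro power_mono) auto
    ultimately have "(1 + x\<^sup>2) * (cmod (F x))\<^sup>2 \<le> A\<^sup>2 + B\<^sup>2"
      by (simp add: power_mult_distrib algebra_simps)
    moreover have "0 < 1 + x\<^sup>2" by (simp add: add_pos_nonneg)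
    ultimately have "(cmod (F x))\<^sup>2 \<le> (A\<^sup>2 + B\<^sup>2) / (1 + x\<^sup>2)"
      by (simp add: pos_le_divide_eq mult.commute)
    then have "(cmod (F x))\<^sup>2 * \<bar>x\<bar> powr (1 - \<alpha>) \<le> (A\<^sup>2 + B\<^sup>2) / (1 + x\<^sup>2) * \<bar>x\<bar> powr (1 - \<alpha>)"
      by (intro mult_right_mono) auto
    then show ?thesis by simp
  qed
  have "integrable lborel (\<lambda>x. (cmod (F x))\<^sup>2 * \<bar>x\<bar> powr (1 - \<alpha>))"
  proof (rule Bochner_Integration.integrable_bound)
    show "integrable lborel (\<lambda>x. (A\<^sup>2 + B\<^sup>2) * (\<bar>x\<bar> powr (2 - \<alpha> - 1) / (1 + x\<^sup>2)))"
      using \<alpha> by (intro integrable_mult_right integrable_powr_div_quadratic) auto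
    show "AE x in lborel. norm ((cmod (F x))\<^sup>2 * \<bar>x\<bar> powr (1 - \<alpha>))
        \<le> norm ((A\<^sup>2 + B\<^sup>2) * (\<bar>x\<bar> powr (2 - \<alpha> - 1) / (1 + x\<^sup>2)))"
      using le by (intro AE_I2) (simp only: real_norm_def abs_of_nonneg zero_le_mult_iff zero_le_power2 powr_ge_zero
          abs_mult abs_divide, smt (verit) le mult_nonneg_nonneg powr_ge_zero zero_le_power2 divide_nonneg_nonneg)
  qed measurable
  then show ?thesis
    using schwartz_space_integrable[OF assms] by (simp add: alpha_finite_def F_def)
qed

text \<open>The factor 2 in the triangle inequality does no harm: only convergence to 0 matters.\<close>

lemma S0_embed_in_S0_space:
  assumes "\<xi> \<in> S0_embed \<alpha> h"
  shows "S0_embed \<alpha> h \<in> S0_space \<alpha>"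
proof -
  have h: "alpha_finite \<alpha> h"
    using assms by (simp add: S0_embed_def alpha_finite_def)
  have fin: "alpha_finite \<alpha> f" if "f \<in> schwartz_space" for f
    using that by (rule alpha_finite_schwartz)
  have embed: "\<eta> \<in> S0_embed \<alpha> h \<longleftrightarrow>
      (\<forall>n. \<eta> n \<in> schwartz_space) \<and> (\<lambda>n. alpha_norm \<alpha> (\<lambda>x. \<eta> n x - h x)) \<longlonglongrightarrow> 0" for \<eta>
    using h by (auto simp: S0_embed_def alpha_finite_def)
  have cauchy: "\<eta> \<in> alpha_cauchy \<alpha>" if "\<eta> \<in> S0_embed \<alpha> h" for \<eta>
  proof -
    have \<eta>: "\<And>n. \<eta> n \<in> schwartz_space" "(\<lambda>n. alpha_norm \<alpha> (\<lambda>x. \<eta> n x - h x)) \<longlonglongrightarrow> 0"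
      using that embed by auto
    have "\<exists>N. \<forall>m\<ge>N. \<forall>n\<ge>N. alpha_norm \<alpha> (\<lambda>x. \<eta> m x - \<eta> n x) < e" if "0 < e" for e
    proof -
      obtain N where N: "\<And>n. N \<le> n \<Longrightarrow> alpha_norm \<alpha> (\<lambda>x. \<eta> n x - h x) < e / 4"
        using order_tendstoD(2)[OF \<eta>(2), of "e / 4"] \<open>0 < e\<close> by (auto simp: eventually_sequentially)
      have "alpha_norm \<alpha> (\<lambda>x. \<eta> m x - \<eta> n x) < e" if "N \<le> m" "N \<le> n" for m n
        using alpha_norm_triangle[OF fin[OF \<eta>(1)] h fin[OF \<eta>(1)], of m n]
          N[OF that(1)] N[OF that(2)] alpha_norm_diff_commute[of h "\<eta> n"] by simp
      then show ?thesis by blast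
    qed
    then show ?thesis using \<eta>(1) by (simp add: alpha_cauchy_def)
  qed
  \<comment> \<open>An element of the quotient is an entire class, so sequences equivalent to \<xi>
    must converge to h as well; hence both inclusions.\<close>
  have "S0_embed \<alpha> h = alpha_equiv \<alpha> `` {\<xi>}"
  proof (intro equalityI subsetI)
    fix \<eta> assume \<eta>: "\<eta> \<in> S0_embed \<alpha> h"
    have "(\<lambda>n. alpha_norm \<alpha> (\<lambda>x. \<xi> n x - \<eta> n x)) \<longlonglongrightarrow> 0"
    proof (rule LIMSEQ_zero_squeeze[OF alpha_norm_nonneg])
      show "alpha_norm \<alpha> (\<lambda>x. \<xi> n x - \<eta> n x) \<le>
          2 * (alpha_norm \<alpha> (\<lambda>x. \<xi> n x - h x) + alpha_norm \<alpha> (\<lambda>x. \<eta> n x - h x))" for n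
        using alpha_norm_triangle[OF fin h fin, of "\<xi> n" "\<eta> n"] assms \<eta> alpha_norm_diff_commute[of h "\<eta> n"]
        unfolding embed by simp
    qed (use assms \<eta> embed in blast)+
    then show "\<eta> \<in> alpha_equiv \<alpha> `` {\<xi>}"
      using cauchy[OF assms] cauchy[OF \<eta>] by (simp add: alpha_equiv_def)
  next
    fix \<eta> assume "\<eta> \<in> alpha_equiv \<alpha> `` {\<xi>}"
    then have \<eta>: "\<And>n. \<eta> n \<in> schwartz_space" "(\<lambda>n. alpha_norm \<alpha> (\<lambda>x. \<xi> n x - \<eta> n x)) \<longlonglongrightarrow> 0"
      by (auto simp: alpha_equiv_def alpha_cauchy_def)
    have "(\<lambda>n. alpha_norm \<alpha> (\<lambda>x. \<eta> n x - h x)) \<longlonglongrightarrow> 0"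
    proof (rule LIMSEQ_zero_squeeze[OF alpha_norm_nonneg])
      show "alpha_norm \<alpha> (\<lambda>x. \<eta> n x - h x) \<le>
          2 * (alpha_norm \<alpha> (\<lambda>x. \<xi> n x - \<eta> n x) + alpha_norm \<alpha> (\<lambda>x. \<xi> n x - h x))" for n
        using alpha_norm_triangle[OF fin fin h, of "\<eta> n" "\<xi> n"] assms \<eta> alpha_norm_diff_commute[of "\<eta> n"]
        unfolding embed by simp
    qed (use assms \<eta> embed in blast)+
    then show "\<eta> \<in> S0_embed \<alpha> h" using \<eta>(1) embed by blast
  qed
  then show ?thesis
    unfolding S0_space_def using cauchy[OF assms] by (simp add: quotientI)
qed

end

section \<open>Approximation of the indicator functions\<close>

lemma fourier_indicator:
  assumes "0 < t" "x \<noteq> 0"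
  shows "fourier (\<lambda>y. complex_of_real (indicator {0..<t} y)) x
    = complex_of_real (1 / sqrt (2 * pi)) * ((cis (t * x) - 1) / (\<i> * of_real x))"
proof -
  have "AE y in lborel. y \<noteq> t" by (rule AE_lborel_singleton)
  then have "(LINT y|lborel. cis (x * y) * complex_of_real (indicator {0..<t} y))
      = (LINT y|lborel. indicator {0..t} y *\<^sub>R cis (x * y))"
    by (intro integral_cong_AE) (auto simp: indicator_def elim!: eventually_mono)
  also have "\<dots> = cis (x * t) / (\<i> * of_real x) - cis (x * 0) / (\<i> * of_real x)"
  proof (rule integral_FTC_Icc[where F = "\<lambda>y. cis (x * y) / (\<i> * of_real x)"])
    fix y
    have "((\<lambda>y. cis (x * y) / (\<i> * of_real x)) has_vector_derivative (\<i> * of_real x * cis (x * y)) / (\<i> * of_real x)) (at y)"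
      by (intro has_vector_derivative_divide has_vector_derivative_cis)
    then show "((\<lambda>y. cis (x * y) / (\<i> * of_real x)) has_vector_derivative cis (x * y)) (at y within {0..t})"
      using assms(2) by (simp add: has_vector_derivative_at_within)
  next
    show "continuous_on {0..t} (\<lambda>y. cis (x * y))"
      by (auto intro!: continuous_intros)
  qed (use assms in auto)
  finally show ?thesis
    unfolding fourier_def by (simp add: diff_divide_distrib mult.commute)
qed

lemma cmod_cis_minus_1_sq: "(cmod (cis a - 1))\<^sup>2 = 2 * (1 - cos a)"
proof -
  have "(cmod (cis a - 1))\<^sup>2 = (sin a)\<^sup>2 + (cos a)\<^sup>2 + 1 - 2 * cos a"
    by (simp add: cmod_power2 power2_diff)
  then show ?thesis by simp
qed

text \<open>The prefactor 1 / (2 pi) and |exp(i t x) - 1|^2 = 2 (1 - cos(t x)) combine to 1 / pi,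
  while the denominator x^2 lowers the exponent of the weight by 2.\<close>

lemma fourier_indicator_sq:
  assumes "0 < t" "x \<noteq> 0"
  shows "(cmod (fourier (\<lambda>y. complex_of_real (indicator {0..<t} y)) x))\<^sup>2 * \<bar>x\<bar> powr (1 - \<alpha>)
    = (1 - cos (t * x)) * \<bar>x\<bar> powr (- 1 - \<alpha>) / pi"
proof -
  have "(cmod (fourier (\<lambda>y. complex_of_real (indicator {0..<t} y)) x))\<^sup>2 = (1 - cos (t * x)) / (pi * \<bar>x\<bar>\<^sup>2)"
    unfolding fourier_indicator[OF assms]
    by (simp add: norm_mult norm_divide power_mult_distrib power_divide cmod_cis_minus_1_sq)
       (simp add: field_simps assms(2))
  moreover have "\<bar>x\<bar> powr (1 - \<alpha>) = \<bar>x\<bar>\<^sup>2 * \<bar>x\<bar> powr (- 1 - \<alpha>)"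
    using assms(2) powr_add[of "\<bar>x\<bar>" 2 "- 1 - \<alpha>"] by simp
  ultimately show ?thesis using assms(2) by simp
qed

lemma has_bochner_integral_fourier_indicator:
  assumes "0 < \<alpha>" "\<alpha> < 2" "0 < t"
  shows "has_bochner_integral lborel
    (\<lambda>x. (cmod (fourier (\<lambda>y. complex_of_real (indicator {0..<t} y)) x))\<^sup>2 * \<bar>x\<bar> powr (1 - \<alpha>))
    (t powr \<alpha> / C_const \<alpha>)"
proof -
  have "AE x in lborel. x \<noteq> (0::real)" by (rule AE_lborel_singleton)
  then have AE: "AE x in lborel. (cmod (fourier (\<lambda>y. complex_of_real (indicator {0..<t} y)) x))\<^sup>2 * \<bar>x\<bar> powr (1 - \<alpha>)
      = (1 - cos (t * x)) * \<bar>x\<bar> powr (- 1 - \<alpha>) / pi"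
    using fourier_indicator_sq[OF assms(3)] by (auto elim!: eventually_mono)
  have "has_bochner_integral lborel (\<lambda>x. (1 - cos (t * x)) * \<bar>x\<bar> powr (- 1 - \<alpha>) / pi)
      (t powr \<alpha> * (pi / C_const \<alpha>) / pi)"
    by (intro has_bochner_integral_divide has_bochner_integral_one_minus_cos assms)
  then show ?thesis
    by (subst has_bochner_integral_cong_AE[OF _ _ AE]) auto
qed

lemma alpha_finite_indicator:
  assumes "0 < \<alpha>" "\<alpha> < 2" "0 < t"
  shows "alpha_finite \<alpha> (indicator {0..<t})"
proof -
  have "integrable lborel (indicator {0..<t} :: real \<Rightarrow> real)"
    using assms by (intro integrable_real_indicator) auto
  then show ?thesis
    using has_bochner_integral_fourier_indicator[OF assms]
    by (auto simp: alpha_finite_def has_bochner_integral_iff)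
qed

text \<open>For an antiderivative G of \<phi>, G(x) - G(x - t) is the integral of \<phi> over
  [x - t, x], that is, the convolution of \<phi> with the indicator of [0, t).\<close>

lemma schwartz_space_antiderivative_diff:
  fixes \<phi> :: "real \<Rightarrow> real"
  assumes \<phi>: "\<phi> \<in> schwartz_space" and "0 < t"
  obtains \<xi> where "\<xi> \<in> schwartz_space" "\<And>x. (\<xi> has_vector_derivative \<phi> x - \<phi> (x - t)) (at x)"
proof -
  have "isCont \<phi> x" for x
    using schwartz_space_continuous_on[OF \<phi>, of UNIV] by (simp add: continuous_on_eq_continuous_at)
  then obtain G where G: "\<And>x. (G has_vector_derivative \<phi> x) (at x)"
    using einterval_antiderivative[of "-\<infinity>" \<infinity> \<phi>] by auto
  define \<xi> where "\<xi> x = G x - G (x - t)" for x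
  have "((G \<circ> (\<lambda>x. x - t)) has_vector_derivative (1 *\<^sub>R \<phi> (x - t))) (at x)" for x
    by (intro vector_diff_chain_at G) (auto intro!: derivative_eq_intros)
  then have deriv: "(\<xi> has_vector_derivative \<phi> x - \<phi> (x - t)) (at x)" for x
    unfolding \<xi>_def using G by (intro has_vector_derivative_diff) (auto simp: o_def)
  have diff: "(\<lambda>x. \<phi> x - \<phi> (x - t)) \<in> schwartz_space"
    by (intro schwartz_space_diff schwartz_space_shift \<phi>)
  have "\<xi> \<in> schwartz_space"
  \<comment> \<open>The derivative of \<xi> is already a Schwartz function, so adjoining the single
    function \<xi> gives a closed class and only the decay of \<xi> itself is left.\<close>
  proof (rule schwartz_space_coinduct[where S = "insert \<xi> schwartz_space"])
    fix f assume "f \<in> insert \<xi> (schwartz_space :: (real \<Rightarrow> real) set)"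
    then show "\<exists>f'\<in>insert \<xi> schwartz_space. \<forall>x. (f has_vector_derivative f' x) (at x)"
    proof
      assume "f = \<xi>"
      then show ?thesis using deriv diff by (intro bexI[of _ "\<lambda>x. \<phi> x - \<phi> (x - t)"]) auto
    next
      assume "f \<in> schwartz_space"
      then show ?thesis using schwartz_space_deriv by (metis insertI2)
    qed
  next
    fix f :: "real \<Rightarrow> real" and m
    assume f: "f \<in> insert \<xi> (schwartz_space :: (real \<Rightarrow> real) set)"
    obtain B where B: "\<And>x. \<bar>x\<bar> ^ m * norm (\<phi> x) \<le> B"
      using schwartz_space_bound[OF \<phi>] by blast
    obtain C where C: "\<And>x. \<bar>x\<bar> ^ 0 * norm (\<phi> x) \<le> C"
      using schwartz_space_bound[OF \<phi>] by blast
    have "\<bar>x\<bar> ^ m * norm (\<xi> x) \<le> t * (2 ^ m * (B + t ^ m * C))" for x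
    proof -
      \<comment> \<open>The mean value theorem gives \<xi> x = t \<phi>(z) with z within distance t
        of x, so \<xi> inherits the decay of \<phi>.\<close>
      have "\<exists>z. x - t < z \<and> z < x \<and> G x - G (x - t) = (x - (x - t)) * \<phi> z"
        using \<open>0 < t\<close> G by (intro MVT2) (auto simp: has_real_derivative_iff_has_vector_derivative)
      then obtain z where z: "x - t < z" "z < x" "\<xi> x = t * \<phi> z"
        by (auto simp: \<xi>_def)
      have "\<bar>x - z\<bar> ^ m \<le> t ^ m" using z by (intro power_mono) auto
      then have "\<bar>x\<bar> ^ m \<le> 2 ^ m * (\<bar>z\<bar> ^ m + t ^ m)"
        using abs_power_le_shift[of x m z]
        by (meson add_left_mono mult_left_mono order_trans zero_le_numeral zero_le_power)
      then have "\<bar>x\<bar> ^ m * norm (\<phi> z) \<le> 2 ^ m * (\<bar>z\<bar> ^ m + t ^ m) * norm (\<phi> z)"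
        by (intro mult_right_mono) auto
      also have "\<dots> = 2 ^ m * (\<bar>z\<bar> ^ m * norm (\<phi> z) + t ^ m * norm (\<phi> z))"
        by (simp add: algebra_simps)
      also have "\<dots> \<le> 2 ^ m * (B + t ^ m * C)"
        using B[of z] C[of z] \<open>0 < t\<close> by (intro mult_left_mono add_mono) auto
      finally have "t * (\<bar>x\<bar> ^ m * norm (\<phi> z)) \<le> t * (2 ^ m * (B + t ^ m * C))"
        using \<open>0 < t\<close> by (intro mult_left_mono) auto
      then show ?thesis using z(3) \<open>0 < t\<close> by (simp add: abs_mult mult_ac)
    qed
    then show "\<exists>B. \<forall>x. \<bar>x\<bar> ^ m * norm (f x) \<le> B"
      using f schwartz_space_bound[of f m] by blast
  qed simp
  then show ?thesis using deriv that by blast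
qed

lemma fourier_shift: "fourier (\<lambda>y. f (y - t)) x = cis (t * x) * fourier f x"
proof -
  have "(LINT y|lborel. cis (x * y) * f (y - t)) = (LINT y|lborel. cis (x * (t + y)) * f y)"
    by (subst lborel_integral_real_affine[where c = 1 and t = t]) auto
  also have "\<dots> = (LINT y|lborel. cis (t * x) * (cis (x * y) * f y))"
    by (simp add: distrib_left cis_mult[symmetric] mult_ac)
  finally show ?thesis unfolding fourier_def by simp
qed

lemma fourier_gaussian:
  assumes "0 < c"
  shows "fourier (\<lambda>y. complex_of_real (c * std_normal_density (c * y))) x
    = complex_of_real (1 / sqrt (2 * pi) * exp (- (x / c)\<^sup>2 / 2))"
proof -
  have "(LINT y|lborel. cis (x * y) * complex_of_real (c * std_normal_density (c * y)))
      = c *\<^sub>R (LINT y|lborel. cis (x / c * (0 + c * y)) * complex_of_real (std_normal_density (0 + c * y)))"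
    using assms by (simp add: mult.left_commute scaleR_conv_of_real)
  also have "\<dots> = (LINT y|lborel. cis (x / c * y) * complex_of_real (std_normal_density y))"
    using assms by (subst (2) lborel_integral_real_affine[where c = c and t = 0]) auto
  also have "\<dots> = char std_normal_distribution (x / c)"
    unfolding char_def by (subst integral_density) (auto simp: cis_conv_exp scaleR_conv_of_real mult.commute)
  also have "\<dots> = complex_of_real (exp (- (x / c)\<^sup>2 / 2))"
    by (simp add: char_std_normal_distribution)
  finally show ?thesis unfolding fourier_def by (simp add: cis_conv_exp)
qed

lemma schwartz_space_std_normal_density:
  assumes "0 < c"
  shows "(\<lambda>y. c * std_normal_density (c * y)) \<in> schwartz_space"
proof -
  have "c * std_normal_density (c * y) = c / sqrt (2 * pi) * exp (- (c\<^sup>2 / 2) * y\<^sup>2)" for y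
    by (simp add: std_normal_density_def power_mult_distrib)
  then show ?thesis using schwartz_space_gaussian[of "c\<^sup>2 / 2" "c / sqrt (2 * pi)"] assms by simp
qed

text \<open>The approximants are the convolutions of the indicator with a Gaussian of width \<open>1 / c\<close>.\<close>

lemma indicator_mollified:
  assumes "0 < c" "0 < t"
  obtains \<xi> :: "real \<Rightarrow> real" where "\<xi> \<in> schwartz_space"
    "\<And>x. x \<noteq> 0 \<Longrightarrow> fourier (\<lambda>y. complex_of_real (\<xi> y)) x =
       complex_of_real (exp (- (x / c)\<^sup>2 / 2)) * fourier (\<lambda>y. complex_of_real (indicator {0..<t} y)) x"
proof -
  define \<phi> where "\<phi> y = c * std_normal_density (c * y)" for y
  have \<phi>: "\<phi> \<in> schwartz_space"
    unfolding \<phi>_def[abs_def] by (rule schwartz_space_std_normal_density[OF assms(1)])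
  obtain \<xi> where \<xi>: "\<xi> \<in> schwartz_space" "\<And>x. (\<xi> has_vector_derivative \<phi> x - \<phi> (x - t)) (at x)"
    using schwartz_space_antiderivative_diff[OF \<phi> assms(2)] by blast
  have diff: "(\<lambda>x. \<phi> x - \<phi> (x - t)) \<in> schwartz_space"
    by (intro schwartz_space_diff schwartz_space_shift \<phi>)
  have "fourier (\<lambda>y. complex_of_real (\<xi> y)) x =
       complex_of_real (exp (- (x / c)\<^sup>2 / 2)) * fourier (\<lambda>y. complex_of_real (indicator {0..<t} y)) x"
    if "x \<noteq> 0" for x
  proof -
    have "((\<lambda>y. complex_of_real (\<xi> y)) has_vector_derivative complex_of_real (\<phi> y - \<phi> (y - t))) (at y)" for y
      by (rule bounded_linear.has_vector_derivative[OF bounded_linear_of_real \<xi>(2)])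
    \<comment> \<open>Transforming \<xi>' = \<phi> - \<phi>(. - t) gives - i x times the transform
      of \<xi> on the left and (1 - exp(i t x)) times that of \<phi> on the right. Division by - i
      x, possible as x \<noteq> 0, produces the transform of the indicator times a Gaussian.\<close>
    then have "- \<i> * of_real x * fourier (\<lambda>y. complex_of_real (\<xi> y)) x
        = fourier (\<lambda>y. complex_of_real (\<phi> y - \<phi> (y - t))) x"
      using fourier_deriv[OF schwartz_space_of_real[OF \<xi>(1)] schwartz_space_of_real[OF diff]] by simp
    also have "\<dots> = fourier (\<lambda>y. complex_of_real (\<phi> y) + - complex_of_real (\<phi> (y - t))) x"
      by simp
    also have "\<dots> = fourier (\<lambda>y. complex_of_real (\<phi> y)) x - cis (t * x) * fourier (\<lambda>y. complex_of_real (\<phi> y)) x"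
      using schwartz_space_integrable[OF \<phi>] schwartz_space_integrable[OF schwartz_space_shift[OF \<phi>]]
      by (subst fourier_add) (auto simp: fourier_minus fourier_shift[of "\<lambda>y. complex_of_real (\<phi> y)"])
    also have "\<dots> = - (cis (t * x) - 1) * complex_of_real (1 / sqrt (2 * pi) * exp (- (x / c)\<^sup>2 / 2))"
      unfolding \<phi>_def fourier_gaussian[OF assms(1)]
      by (simp only: left_diff_distrib minus_diff_eq mult_1)
    finally have "fourier (\<lambda>y. complex_of_real (\<xi> y)) x
        = - (cis (t * x) - 1) * complex_of_real (1 / sqrt (2 * pi) * exp (- (x / c)\<^sup>2 / 2)) / (- \<i> * of_real x)"
      using that by (subst eq_divide_eq) (auto simp: mult.commute)
    also have "\<dots> = (cis (t * x) - 1) * complex_of_real (1 / sqrt (2 * pi) * exp (- (x / c)\<^sup>2 / 2)) / (\<i> * of_real x)"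
      by (simp only: mult_minus_left minus_divide_divide)
    finally show ?thesis
      unfolding fourier_indicator[OF assms(2) that] by (simp add: mult.commute)
  qed
  then show ?thesis using \<xi>(1) that by blast
qed

lemma indicator_approximation:
  assumes "0 < \<alpha>" "\<alpha> < 2" "0 < t"
  obtains \<xi> where "\<xi> \<in> S0_embed \<alpha> (indicator {0..<t})"
    "(\<lambda>n. (alpha_norm \<alpha> (\<xi> n))\<^sup>2) \<longlonglongrightarrow> t powr \<alpha>"
proof -
  define H where "H = fourier (\<lambda>y. complex_of_real (indicator {0..<t} y))"
  \<comment> \<open>The Gaussian factor for width 1 / c with c = n + 1, which is positive already at
    n = 0 and makes the factor tend to 1.\<close>
  define e where "e n x = exp (- (x / real (Suc n))\<^sup>2 / 2)" for n x
  define w where "w x = (cmod (H x))\<^sup>2 * \<bar>x\<bar> powr (1 - \<alpha>)" for x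
  have w: "integrable lborel w" "(LINT x|lborel. w x) = t powr \<alpha> / C_const \<alpha>"
    using has_bochner_integral_fourier_indicator[OF assms]
    by (auto simp: has_bochner_integral_iff w_def[abs_def] H_def)
  have [measurable]: "w \<in> borel_measurable borel" "e n \<in> borel_measurable borel" for n
    using w by (auto simp: e_def[abs_def])
  have "\<exists>\<xi>. \<xi> \<in> schwartz_space \<and> (\<forall>x. x \<noteq> 0 \<longrightarrow>
      fourier (\<lambda>y. complex_of_real (\<xi> y)) x = complex_of_real (e n x) * H x)" for n
    unfolding H_def e_def using assms(3) indicator_mollified[of "real (Suc n)" t] by (metis of_nat_0_less_iff zero_less_Suc)
  then obtain \<xi> where \<xi>: "\<And>n. \<xi> n \<in> schwartz_space"
    "\<And>n x. x \<noteq> 0 \<Longrightarrow> fourier (\<lambda>y. complex_of_real (\<xi> n y)) x = complex_of_real (e n x) * H x"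
    by metis
  have e: "0 \<le> e n x" "e n x \<le> 1" for n x by (auto simp: e_def)
  have e_lim: "(\<lambda>n. e n x) \<longlonglongrightarrow> 1" for x
  proof -
    have "(\<lambda>n. x / real (Suc n)) \<longlonglongrightarrow> 0"
      by (rule LIMSEQ_Suc[OF lim_const_over_n])
    then have "(\<lambda>n. exp (- (x / real (Suc n))\<^sup>2 / 2)) \<longlonglongrightarrow> exp (- 0\<^sup>2 / 2)"
      by (intro tendsto_intros) auto
    then show ?thesis unfolding e_def by simp
  qed
  have "AE x in lborel. x \<noteq> (0::real)" by (rule AE_lborel_singleton)
  note AE0 = eventually_mono[OF this]
  have int: "integrable lborel (\<xi> n)" for n by (intro schwartz_space_integrable \<xi>)
  have fin: "alpha_finite \<alpha> (indicator {0..<t})" by (rule alpha_finite_indicator[OF assms])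
  have ind: "integrable lborel (\<lambda>y. - complex_of_real (indicator {0..<t} y))"
    using fin by (auto simp: alpha_finite_def)
  have [measurable]: "\<xi> n \<in> borel_measurable borel" for n
    using int[of n] by auto
  have sq1: "(alpha_norm \<alpha> (\<xi> n))\<^sup>2 = C_const \<alpha> * (LINT x|lborel. (e n x)\<^sup>2 * w x)" for n
    unfolding alpha_norm_sq[OF assms(1,2)]
  proof (intro arg_cong[where f = "\<lambda>z. C_const \<alpha> * z"] integral_cong_AE AE0)
    fix x :: real assume "x \<noteq> 0"
    then show "(cmod (fourier (\<lambda>y. complex_of_real (\<xi> n y)) x))\<^sup>2 * \<bar>x\<bar> powr (1 - \<alpha>) = (e n x)\<^sup>2 * w x"
      by (simp add: \<xi>(2) w_def norm_mult power_mult_distrib)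
  qed measurable
  have sq2: "(alpha_norm \<alpha> (\<lambda>x. \<xi> n x - indicator {0..<t} x))\<^sup>2 = C_const \<alpha> * (LINT x|lborel. (e n x - 1)\<^sup>2 * w x)" for n
    unfolding alpha_norm_sq[OF assms(1,2)]
  proof (intro arg_cong[where f = "\<lambda>z. C_const \<alpha> * z"] integral_cong_AE AE0)
    fix x :: real assume x: "x \<noteq> 0"
    have "fourier (\<lambda>y. complex_of_real (\<xi> n y - indicator {0..<t} y)) x
        = fourier (\<lambda>y. complex_of_real (\<xi> n y) + - complex_of_real (indicator {0..<t} y)) x"
      by simp
    also have "\<dots> = complex_of_real (e n x - 1) * H x"
      using int[of n] ind
      by (subst fourier_add) (auto simp: fourier_minus \<xi>(2)[OF x] left_diff_distrib simp flip: H_def)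
    finally show "(cmod (fourier (\<lambda>y. complex_of_real (\<xi> n y - indicator {0..<t} y)) x))\<^sup>2 * \<bar>x\<bar> powr (1 - \<alpha>)
        = (e n x - 1)\<^sup>2 * w x"
      by (simp add: w_def norm_mult power_mult_distrib del: of_real_diff)
  qed measurable
  \<comment> \<open>One dominated convergence covers both claims: a = 1 gives the squared distance
    to the indicator and a = 0 the squared norm. The values of e and a lie in [0, 1], so w itself
    dominates.\<close>
  have dom: "(\<lambda>n. LINT x|lborel. (e n x - a)\<^sup>2 * w x) \<longlonglongrightarrow> (LINT x|lborel. (1 - a)\<^sup>2 * w x)"
    if a: "0 \<le> a" "a \<le> 1" for a
  proof (rule integral_dominated_convergence[OF _ _ w(1)])
    show "AE x in lborel. (\<lambda>n. (e n x - a)\<^sup>2 * w x) \<longlonglongrightarrow> (1 - a)\<^sup>2 * w x"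
      by (intro AE_I2 tendsto_intros e_lim)
    show "AE x in lborel. norm ((e n x - a)\<^sup>2 * w x) \<le> w x" for n
    proof (intro AE_I2)
      fix x
      have "\<bar>e n x - a\<bar> \<le> 1" using e[of n x] a by (auto simp: abs_le_iff)
      then have "(e n x - a)\<^sup>2 \<le> 1" by (simp add: abs_square_le_1)
      moreover have "0 \<le> w x" by (simp add: w_def)
      ultimately show "norm ((e n x - a)\<^sup>2 * w x) \<le> w x" by (simp add: mult_left_le_one_le)
    qed
  qed measurable
  show ?thesis
  proof
    have "(\<lambda>n. C_const \<alpha> * (LINT x|lborel. (e n x - 1)\<^sup>2 * w x)) \<longlonglongrightarrow> C_const \<alpha> * (LINT x|lborel. (1 - 1)\<^sup>2 * w x)"
      by (intro tendsto_intros dom) auto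
    then have "(\<lambda>n. sqrt ((alpha_norm \<alpha> (\<lambda>x. \<xi> n x - indicator {0..<t} x))\<^sup>2)) \<longlonglongrightarrow> sqrt 0"
      unfolding sq2 by (intro tendsto_real_sqrt) simp
    then show "\<xi> \<in> S0_embed \<alpha> (indicator {0..<t})"
      using fin \<xi>(1) alpha_norm_nonneg[OF assms(1,2)] by (simp add: S0_embed_def alpha_finite_def)
    have "(\<lambda>n. C_const \<alpha> * (LINT x|lborel. (e n x - 0)\<^sup>2 * w x)) \<longlonglongrightarrow> C_const \<alpha> * (LINT x|lborel. (1 - 0)\<^sup>2 * w x)"
      by (intro tendsto_intros dom) auto
    then show "(\<lambda>n. (alpha_norm \<alpha> (\<xi> n))\<^sup>2) \<longlonglongrightarrow> t powr \<alpha>"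
      unfolding sq1 using C_const_pos[OF assms(1,2)] by (simp add: w(2))
  qed
qed

section \<open>The characteristic function of the marginals\<close>

lemma space_weak_dual_borel: "space weak_dual_borel = tempered_distributions"
  by (simp add: weak_dual_borel_def space_measure_of_conv)

lemma eval_measurable_weak_dual_borel:
  assumes "\<xi> \<in> schwartz_space"
  shows "(\<lambda>\<omega>. \<omega> \<xi>) \<in> borel_measurable weak_dual_borel"
proof (rule borel_measurableI)
  fix U :: "real set" assume "open U"
  then have "openin weak_dual_topology {\<omega> \<in> tempered_distributions. \<omega> \<xi> \<in> U}"
    unfolding weak_dual_topology_def using assms by (intro topology_generated_by_Basis) blast
  moreover have "{W. openin weak_dual_topology W} \<subseteq> Pow tempered_distributions"
  proof
    fix W assume "W \<in> {W. openin weak_dual_topology W}"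
    then have "W \<subseteq> topspace weak_dual_topology" by (simp add: openin_subset)
    also have "\<dots> \<subseteq> tempered_distributions" unfolding weak_dual_topology_def by auto
    finally show "W \<in> Pow tempered_distributions" by simp
  qed
  ultimately have "{\<omega> \<in> tempered_distributions. \<omega> \<xi> \<in> U} \<in> sets weak_dual_borel"
    unfolding weak_dual_borel_def by (simp add: sets_measure_of sigma_sets.Basic)
  moreover have "(\<lambda>\<omega>. \<omega> \<xi>) -` U \<inter> space weak_dual_borel = {\<omega> \<in> tempered_distributions. \<omega> \<xi> \<in> U}"
    by (auto simp: space_weak_dual_borel)
  ultimately show "(\<lambda>\<omega>. \<omega> \<xi>) -` U \<inter> space weak_dual_borel \<in> sets weak_dual_borel" by simp
qed

lemma norm_cis_diff_le: "norm (cis a - cis b) \<le> \<bar>a - b\<bar>"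
proof -
  have "cis a - cis b = cis b * (cis (a - b) - 1)"
    by (simp add: right_diff_distrib cis_mult)
  then have "norm (cis a - cis b) = norm (cis (a - b) - 1)" by (simp add: norm_mult)
  also have "\<dots> \<le> \<bar>a - b\<bar>"
    using iexp_approx1[of "a - b" 0] by (simp add: cis_conv_exp)
  finally show ?thesis .
qed

text \<open>The map cis is 1-Lipschitz, and the linear bound a obtained from it is replaced by e / 2
  + a^2 / (2 e), by completing the square. The L^2 hypothesis then applies directly, without
  Cauchy-Schwarz and without integrability of Z or Y.\<close>

lemma (in prob_space) integral_cis_tendsto:
  assumes [measurable]: "\<And>n. Z n \<in> borel_measurable M" "Y \<in> borel_measurable M"
    and lim: "(\<lambda>n. \<integral>\<^sup>+\<omega>. ennreal ((Z n \<omega> - Y \<omega>)\<^sup>2) \<partial>M) \<longlonglongrightarrow> 0"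
  shows "(\<lambda>n. LINT \<omega>|M. cis (y * Z n \<omega>)) \<longlonglongrightarrow> (LINT \<omega>|M. cis (y * Y \<omega>))"
proof (rule tendstoI)
  fix e :: real assume e: "0 < e"
  \<comment> \<open>Chosen so that y^2 / (2 e) times \<delta> is e / 2 times y^2 / (y^2 + 1),
    strictly below e / 2; the 1 covers y = 0.\<close>
  define \<delta> where "\<delta> = e\<^sup>2 / (y\<^sup>2 + 1)"
  have y: "0 < y\<^sup>2 + 1" by (simp add: add_nonneg_pos)
  have "0 < \<delta>" using e y by (simp add: \<delta>_def)
  then have "\<forall>\<^sub>F n in sequentially. (\<integral>\<^sup>+\<omega>. ennreal ((Z n \<omega> - Y \<omega>)\<^sup>2) \<partial>M) < ennreal \<delta>"
    using order_tendstoD(2)[OF lim] by simp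
  then show "\<forall>\<^sub>F n in sequentially. dist (LINT \<omega>|M. cis (y * Z n \<omega>)) (LINT \<omega>|M. cis (y * Y \<omega>)) < e"
  proof (rule eventually_mono)
    fix n assume n: "(\<integral>\<^sup>+\<omega>. ennreal ((Z n \<omega> - Y \<omega>)\<^sup>2) \<partial>M) < ennreal \<delta>"
    have int: "integrable M (\<lambda>\<omega>. cis (y * V \<omega>))" if [measurable]: "V \<in> borel_measurable M" for V
      by (intro integrable_const_bound[where B = 1]) auto
    have le: "norm (cis (y * Z n \<omega>) - cis (y * Y \<omega>)) \<le> e / 2 + y\<^sup>2 / (2 * e) * (Z n \<omega> - Y \<omega>)\<^sup>2" for \<omega>
    proof -
      define a where "a = \<bar>y * (Z n \<omega> - Y \<omega>)\<bar>"
      have "2 * a * e \<le> a\<^sup>2 + e\<^sup>2"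
        using zero_le_power2[of "a - e"] by (simp add: power2_diff)
      then have "a \<le> e / 2 + a\<^sup>2 / (2 * e)"
        using e by (simp add: field_simps power2_eq_square)
      moreover have "norm (cis (y * Z n \<omega>) - cis (y * Y \<omega>)) \<le> a"
        using norm_cis_diff_le[of "y * Z n \<omega>" "y * Y \<omega>"] by (simp add: a_def right_diff_distrib)
      ultimately show ?thesis by (simp add: a_def power_mult_distrib)
    qed
    have "dist (LINT \<omega>|M. cis (y * Z n \<omega>)) (LINT \<omega>|M. cis (y * Y \<omega>))
        = norm (LINT \<omega>|M. cis (y * Z n \<omega>) - cis (y * Y \<omega>))"
      using int by (simp add: dist_norm)
    also have "ennreal \<dots> \<le> (\<integral>\<^sup>+\<omega>. ennreal (norm (cis (y * Z n \<omega>) - cis (y * Y \<omega>))) \<partial>M)"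
      using int by (intro integral_norm_bound_ennreal) simp
    also have "\<dots> \<le> (\<integral>\<^sup>+\<omega>. ennreal (e / 2) + ennreal (y\<^sup>2 / (2 * e)) * ennreal ((Z n \<omega> - Y \<omega>)\<^sup>2) \<partial>M)"
      using le e by (intro nn_integral_mono) (simp flip: ennreal_mult ennreal_plus)
    also have "\<dots> = ennreal (e / 2) + ennreal (y\<^sup>2 / (2 * e)) * (\<integral>\<^sup>+\<omega>. ennreal ((Z n \<omega> - Y \<omega>)\<^sup>2) \<partial>M)"
      by (subst nn_integral_add) (auto simp: nn_integral_cmult emeasure_space_1)
    also have "\<dots> \<le> ennreal (e / 2) + ennreal (y\<^sup>2 / (2 * e)) * ennreal \<delta>"
      using n by (intro add_left_mono mult_left_mono) auto
    also have "\<dots> = ennreal (e / 2 + y\<^sup>2 / (2 * e) * \<delta>)"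
      using e \<open>0 < \<delta>\<close> by (simp flip: ennreal_mult ennreal_plus)
    also have "e / 2 + y\<^sup>2 / (2 * e) * \<delta> = e / 2 + e / 2 * (y\<^sup>2 / (y\<^sup>2 + 1))"
      using e by (simp add: \<delta>_def power2_eq_square)
    also have "ennreal \<dots> < ennreal e"
    proof (rule ennreal_lessI)
      have "y\<^sup>2 / (y\<^sup>2 + 1) < 1" using y by simp
      then have "e / 2 * (y\<^sup>2 / (y\<^sup>2 + 1)) < e / 2 * 1"
        using e by (intro mult_strict_left_mono) auto
      then show "e / 2 + e / 2 * (y\<^sup>2 / (y\<^sup>2 + 1)) < e" by linarith
    qed (use e in simp)
    finally show "dist (LINT \<omega>|M. cis (y * Z n \<omega>)) (LINT \<omega>|M. cis (y * Y \<omega>)) < e"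
      using e by (simp add: ennreal_less_iff)
  qed
qed

locale grey_brownian_motion =
  fixes \<alpha> \<beta> :: real and \<mu> :: "((real \<Rightarrow> real) \<Rightarrow> real) measure"
    and X :: "(nat \<Rightarrow> real \<Rightarrow> real) set \<Rightarrow> ((real \<Rightarrow> real) \<Rightarrow> real) \<Rightarrow> real"
    and f :: "real \<Rightarrow> real \<Rightarrow> real"
  assumes \<alpha>: "0 < \<alpha>" "\<alpha> < 2" and \<beta>: "0 < \<beta>"
    and grey_measure: "is_grey_measure \<alpha> \<beta> \<mu>"
    and grey_noise: "is_grey_noise \<alpha> \<mu> X"
    and density: "is_marginal_density \<alpha> \<mu> X f"
begin

sublocale prob_space \<mu>
  using grey_measure by (simp add: is_grey_measure_def)

lemma sets_\<mu>: "sets \<mu> = sets weak_dual_borel"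
  using grey_measure by (simp add: is_grey_measure_def)

lemma space_\<mu>: "space \<mu> = tempered_distributions"
  using sets_eq_imp_space_eq[OF sets_\<mu>] by (simp add: space_weak_dual_borel)

text \<open>The defining property fixes the integral of cis(\<omega> \<xi>) only. Replacing \<xi> by
  y \<xi>, which scales the squared norm by y^2, gives the whole characteristic function; almost
  nothing is known of \<omega> except that it lies in \<open>space \<mu>\<close>, hence is
  linear.\<close>

lemma integral_cis_eval:
  assumes "\<xi> \<in> schwartz_space"
  shows "(LINT \<omega>|\<mu>. cis (y * \<omega> \<xi>)) = complex_of_real (Mittag_Leffler \<beta> (- (y\<^sup>2 * (alpha_norm \<alpha> \<xi>)\<^sup>2)))"
proof -
  have "(\<lambda>x. y * \<xi> x) \<in> schwartz_space"
    by (rule schwartz_space_bounded_linear[OF bounded_linear_mult_right assms])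
  then have "(LINT \<omega>|\<mu>. cis (\<omega> (\<lambda>x. y * \<xi> x))) = complex_of_real (Mittag_Leffler \<beta> (- (alpha_norm \<alpha> (\<lambda>x. y * \<xi> x))\<^sup>2))"
    using grey_measure by (simp add: is_grey_measure_def)
  moreover have "(LINT \<omega>|\<mu>. cis (\<omega> (\<lambda>x. y * \<xi> x))) = (LINT \<omega>|\<mu>. cis (y * \<omega> \<xi>))"
    by (intro Bochner_Integration.integral_cong) (simp_all add: space_\<mu> tempered_distribution_scale assms)
  moreover have "(alpha_norm \<alpha> (\<lambda>x. y * \<xi> x))\<^sup>2 = y\<^sup>2 * (alpha_norm \<alpha> \<xi>)\<^sup>2"
  proof -
    have "fourier (\<lambda>z. complex_of_real (y * \<xi> z)) x = y * fourier (\<lambda>z. complex_of_real (\<xi> z)) x" for x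
      by (simp add: fourier_def mult.left_commute)
    then show ?thesis
      unfolding alpha_norm_sq[OF \<alpha>] by (simp add: norm_mult power_mult_distrib mult.assoc mult.left_commute)
  qed
  ultimately show ?thesis by simp
qed

text \<open>The approximating sequence plays two parts: as a member of \<open>S0_embed\<close> it
  shows that this set belongs to \<open>S0_space\<close>, so that the noise hypothesis applies to
  it, and the limit of its norms is carried through the continuous Mittag-Leffler function.\<close>

lemma
  assumes t: "0 < t"
  shows grey_bm_measurable: "grey_bm \<alpha> X t \<in> borel_measurable \<mu>"
    and integral_cis_grey_bm:
      "(LINT \<omega>|\<mu>. cis (y * grey_bm \<alpha> X t \<omega>)) = complex_of_real (Mittag_Leffler \<beta> (- (y\<^sup>2 * t powr \<alpha>)))"
proof -
  obtain \<xi> where \<xi>: "\<xi> \<in> S0_embed \<alpha> (indicator {0..<t})"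
    "(\<lambda>n. (alpha_norm \<alpha> (\<xi> n))\<^sup>2) \<longlonglongrightarrow> t powr \<alpha>"
    using indicator_approximation[OF \<alpha> t] by blast
  have schwartz: "\<xi> n \<in> schwartz_space" for n using \<xi>(1) by (simp add: S0_embed_def)
  note noise = grey_noise[unfolded is_grey_noise_def, rule_format, OF S0_embed_in_S0_space[OF \<alpha> \<xi>(1)]]
  show meas: "grey_bm \<alpha> X t \<in> borel_measurable \<mu>"
    using noise by (simp add: grey_bm_def[abs_def])
  have eval: "(\<lambda>\<omega>. \<omega> (\<xi> n)) \<in> borel_measurable \<mu>" for n
    using eval_measurable_weak_dual_borel[OF schwartz] measurable_cong_sets[OF sets_\<mu> refl] by blast
  have "(\<lambda>n. LINT \<omega>|\<mu>. cis (y * \<omega> (\<xi> n))) \<longlonglongrightarrow> (LINT \<omega>|\<mu>. cis (y * grey_bm \<alpha> X t \<omega>))"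
    using noise \<xi>(1) by (intro integral_cis_tendsto eval meas) (auto simp: grey_bm_def)
  moreover have "(\<lambda>n. LINT \<omega>|\<mu>. cis (y * \<omega> (\<xi> n))) \<longlonglongrightarrow> complex_of_real (Mittag_Leffler \<beta> (- (y\<^sup>2 * t powr \<alpha>)))"
    unfolding integral_cis_eval[OF schwartz]
    by (intro tendsto_of_real isCont_tendsto_compose[OF isCont_Mittag_Leffler[OF \<beta>]] tendsto_intros \<xi>(2))
  ultimately show "(LINT \<omega>|\<mu>. cis (y * grey_bm \<alpha> X t \<omega>)) = complex_of_real (Mittag_Leffler \<beta> (- (y\<^sup>2 * t powr \<alpha>)))"
    by (rule LIMSEQ_unique)
qed

text \<open>A characteristic function is bounded by 1, so the estimate comes from probability and
  not from the alternating series. It is uniform in y and t, as the exchange of the time and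
  frequency integrals demands.\<close>

lemma Mittag_Leffler_le_1:
  assumes "0 \<le> t"
  shows "\<bar>Mittag_Leffler \<beta> (- (y\<^sup>2 * t powr \<alpha>))\<bar> \<le> 1"
proof (cases "t = 0")
  case True
  then show ?thesis by (simp add: Mittag_Leffler_0)
next
  case False
  then have t: "0 < t" using assms by simp
  have "norm (LINT \<omega>|\<mu>. cis (y * grey_bm \<alpha> X t \<omega>)) \<le> (LINT \<omega>|\<mu>. norm (cis (y * grey_bm \<alpha> X t \<omega>)))"
    by (rule integral_norm_bound)
  then show ?thesis unfolding integral_cis_grey_bm[OF t] by (simp add: prob_space)
qed

lemma
  assumes t: "0 < t"
  shows density_integrable: "integrable lborel (\<lambda>x. f x t)"
    and integral_density_cis: "(LINT x|lborel. complex_of_real (f x t) * cis (x * y)) =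
      complex_of_real (Mittag_Leffler \<beta> (- (y\<^sup>2 * t powr \<alpha>)))"
proof -
  have nn: "0 \<le> f x t" for x
    using density t by (simp add: is_marginal_density_def)
  have dist: "distributed \<mu> lborel (grey_bm \<alpha> X t) (\<lambda>x. ennreal (f x t))"
    using density t by (simp add: is_marginal_density_def)
  have meas [measurable]: "(\<lambda>x. f x t) \<in> borel_measurable borel"
    using distributed_real_measurable[OF _ dist] nn by simp
  have "(\<integral>\<^sup>+x. ennreal (f x t) \<partial>lborel) = 1"
    using distributed_nn_integral[OF dist, of "\<lambda>_. 1"] by (simp add: emeasure_space_1)
  then show "integrable lborel (\<lambda>x. f x t)"
    using nn by (intro integrableI_nonneg) auto
  have "(LINT \<omega>|\<mu>. cis (y * grey_bm \<alpha> X t \<omega>)) = (LINT x|distr \<mu> lborel (grey_bm \<alpha> X t). cis (y * x))"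
    using grey_bm_measurable[OF t] by (subst integral_distr) auto
  also have "\<dots> = (LINT x|lborel. complex_of_real (f x t) * cis (x * y))"
    unfolding distributed_distr_eq_density[OF dist] using nn
    by (subst integral_density) (auto simp: scaleR_conv_of_real mult.commute)
  finally show "(LINT x|lborel. complex_of_real (f x t) * cis (x * y)) =
      complex_of_real (Mittag_Leffler \<beta> (- (y\<^sup>2 * t powr \<alpha>)))"
    unfolding integral_cis_grey_bm[OF t] ..
qed

end

section \<open>The stretched fractional diffusion equation\<close>

text \<open>The product of two integrable functions dominates. Both Fubini exchanges below have this
  shape, with the remaining factor of modulus at most 1.\<close>

lemma integrable_lborel_pair_bound:
  fixes F :: "real \<times> real \<Rightarrow> complex" and a :: "real \<Rightarrow> real" and b :: "real \<Rightarrow> complex"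
  assumes a: "integrable lborel a" and b: "integrable lborel b"
    and [measurable]: "F \<in> borel_measurable (lborel \<Otimes>\<^sub>M lborel)"
    and le: "\<And>x y. norm (F (x, y)) \<le> norm (a x) * norm (b y)"
  shows "integrable (lborel \<Otimes>\<^sub>M lborel) F"
proof (rule integrableI_bounded)
  have [measurable]: "a \<in> borel_measurable borel" "b \<in> borel_measurable borel" using a b by auto
  have "(\<integral>\<^sup>+p. ennreal (norm (F p)) \<partial>(lborel \<Otimes>\<^sub>M lborel)) = (\<integral>\<^sup>+x. (\<integral>\<^sup>+y. ennreal (norm (F (x, y))) \<partial>lborel) \<partial>lborel)"
    by (subst lborel.nn_integral_fst) auto
  also have "\<dots> \<le> (\<integral>\<^sup>+x. (\<integral>\<^sup>+y. ennreal (norm (a x)) * ennreal (norm (b y)) \<partial>lborel) \<partial>lborel)"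
    using le by (intro nn_integral_mono) (simp flip: ennreal_mult)
  also have "\<dots> = (\<integral>\<^sup>+x. ennreal (norm (a x)) \<partial>lborel) * (\<integral>\<^sup>+y. ennreal (norm (b y)) \<partial>lborel)"
    by (simp add: nn_integral_cmult nn_integral_multc)
  also have "\<dots> < \<infinity>"
    using a b by (simp add: integrable_iff_bounded ennreal_mult_less_top)
  finally show "(\<integral>\<^sup>+p. ennreal (norm (F p)) \<partial>(lborel \<Otimes>\<^sub>M lborel)) < \<infinity>" .
qed measurable

context grey_brownian_motion
begin

lemma density_distr_tempered:
  assumes "0 \<le> t"
  shows "density_distr f t \<in> tempered_distributions"
  using assms density_integrable[of t] dirac_distr_tempered regular_distr_tempered
  by (auto simp: density_distr_def)

text \<open>By Fubini, pairing the density with the transform of \<psi> is the same as pairing its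
  characteristic function with \<psi>. Time 0 fits the same formula: the characteristic function of
  \<delta> is 1 = E_beta(0).\<close>

lemma fourier_density_distr:
  assumes "0 \<le> t" and \<psi>: "\<psi> \<in> schwartz_space"
  shows "fourier_distr (density_distr f t) \<psi> = complex_of_real (1 / sqrt (2 * pi)) *
    (LINT y|lborel. \<psi> y * complex_of_real (Mittag_Leffler \<beta> (- (y\<^sup>2 * t powr \<alpha>))))"
proof (cases "t = 0")
  case True
  then show ?thesis
    using \<psi> fourier_schwartz_space[OF \<psi>]
    by (simp add: fourier_distr_def density_distr_def dirac_distr_def fourier_def Mittag_Leffler_0)
next
  case False
  then have t: "0 < t" using assms by simp
  define c where "c = complex_of_real (1 / sqrt (2 * pi))"
  have [measurable]: "\<psi> \<in> borel_measurable borel" "(\<lambda>x. f x t) \<in> borel_measurable borel"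
    using schwartz_space_integrable[OF \<psi>] density_integrable[OF t] by auto
  have int: "integrable (lborel \<Otimes>\<^sub>M lborel) (\<lambda>(x, y). complex_of_real (f x t) * (cis (x * y) * \<psi> y))"
    by (rule integrable_lborel_pair_bound[OF density_integrable[OF t] schwartz_space_integrable[OF \<psi>]])
       (auto simp: norm_mult)
  have "(LINT x|lborel. complex_of_real (f x t) * fourier \<psi> x)
      = c * (LINT x|lborel. LINT y|lborel. complex_of_real (f x t) * (cis (x * y) * \<psi> y))"
    unfolding fourier_def c_def[symmetric] integral_mult_right_zero
    by (simp only: mult.left_commute[of _ c] integral_mult_right_zero)
  also have "(LINT x|lborel. LINT y|lborel. complex_of_real (f x t) * (cis (x * y) * \<psi> y))
      = (LINT y|lborel. LINT x|lborel. complex_of_real (f x t) * (cis (x * y) * \<psi> y))"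
    by (rule lborel_pair.Fubini_integral[OF int, symmetric])
  also have "\<dots> = (LINT y|lborel. LINT x|lborel. \<psi> y * (complex_of_real (f x t) * cis (x * y)))"
    by (simp add: mult_ac)
  also have "\<dots> = (LINT y|lborel. \<psi> y * complex_of_real (Mittag_Leffler \<beta> (- (y\<^sup>2 * t powr \<alpha>))))"
    unfolding integral_mult_right_zero integral_density_cis[OF t] ..
  finally show ?thesis
    using \<psi> fourier_schwartz_space[OF \<psi>] False
    by (simp add: fourier_distr_def density_distr_def regular_distr_def c_def)
qed

lemma density_distr_equation:
  assumes t: "0 < t" and \<phi>: "\<phi> \<in> schwartz_space"
  shows "set_integrable lborel {0..t} (\<lambda>s. complex_of_real (stretched_kernel \<alpha> \<beta> t s) *
      mult_distr (\<lambda>y. - (complex_of_real y)\<^sup>2) (fourier_distr (density_distr f s)) \<phi>)" (is ?int)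
    and "fourier_distr (density_distr f t) \<phi> =
      fourier_distr dirac_distr \<phi> + complex_of_real (1 / Gamma \<beta>) *
        (LINT s:{0..t}|lborel. complex_of_real (stretched_kernel \<alpha> \<beta> t s) *
          mult_distr (\<lambda>y. - (complex_of_real y)\<^sup>2) (fourier_distr (density_distr f s)) \<phi>)" (is ?eq)
proof -
  define c where "c = complex_of_real (1 / sqrt (2 * pi))"
  define E where "E s y = Mittag_Leffler \<beta> (- (y\<^sup>2 * s powr \<alpha>))" for s y
  define k where "k s = indicator {0..t} s *\<^sub>R stretched_kernel \<alpha> \<beta> t s" for s
  \<comment> \<open>The factor - y^2 is moved onto the test function, so that it costs no
    integrability: \<psi> is again a Schwartz function.\<close>
  define \<psi> where "\<psi> y = - (complex_of_real y)\<^sup>2 * \<phi> y" for y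
  define G where "G s y = complex_of_real (k s) * (\<psi> y * complex_of_real (E s y))" for s y
  have "\<psi> y = - (y *\<^sub>R (y *\<^sub>R \<phi> y))" for y
    by (simp add: \<psi>_def power2_eq_square scaleR_conv_of_real)
  moreover have "(\<lambda>y. - (y *\<^sub>R (y *\<^sub>R \<phi> y))) \<in> schwartz_space"
    by (intro schwartz_space_bounded_linear[OF bounded_linear_minus[OF bounded_linear_ident]]
        schwartz_space_mult_ident \<phi>)
  ultimately have \<psi>: "\<psi> \<in> schwartz_space" by (simp add: \<psi>_def[abs_def])
  have k: "integrable lborel k"
    using stretched_kernel_integrable[OF \<alpha>(1) \<beta> t] by (simp add: k_def[abs_def] set_integrable_def)
  have "continuous_on UNIV (Mittag_Leffler \<beta>)"
    using isCont_Mittag_Leffler[OF \<beta>] by (simp add: continuous_at_imp_continuous_on)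
  then have [measurable]: "Mittag_Leffler \<beta> \<in> borel_measurable borel"
    by (rule borel_measurable_continuous_onI)
  have [measurable]: "k \<in> borel_measurable borel" "\<psi> \<in> borel_measurable borel" "\<phi> \<in> borel_measurable borel"
    using k schwartz_space_integrable[OF \<psi>] schwartz_space_integrable[OF \<phi>] by auto
  have int: "integrable (lborel \<Otimes>\<^sub>M lborel) (\<lambda>(s, y). G s y)"
  proof (rule integrable_lborel_pair_bound[OF k schwartz_space_integrable[OF \<psi>]])
    show "(\<lambda>(s, y). G s y) \<in> borel_measurable (lborel \<Otimes>\<^sub>M lborel)"
      unfolding G_def E_def by measurable
    show "norm (case (s, y) of (s, y) \<Rightarrow> G s y) \<le> norm (k s) * norm (\<psi> y)" for s y
    proof (cases "0 \<le> s")
      case True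
      then have "\<bar>k s\<bar> * (norm (\<psi> y) * \<bar>E s y\<bar>) \<le> \<bar>k s\<bar> * (norm (\<psi> y) * 1)"
        unfolding E_def by (intro mult_left_mono Mittag_Leffler_le_1) auto
      then show ?thesis by (simp add: G_def norm_mult)
    qed (simp add: G_def k_def)
  qed
  have integrand: "indicator {0..t} s *\<^sub>R (complex_of_real (stretched_kernel \<alpha> \<beta> t s) *
      mult_distr (\<lambda>y. - (complex_of_real y)\<^sup>2) (fourier_distr (density_distr f s)) \<phi>)
    = c * (LINT y|lborel. G s y)" for s
  proof (cases "s \<in> {0..t}")
    case True
    have "mult_distr (\<lambda>y. - (complex_of_real y)\<^sup>2) (fourier_distr (density_distr f s)) \<phi>
        = fourier_distr (density_distr f s) \<psi>"
      using \<phi> by (simp add: mult_distr_def \<psi>_def[abs_def])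
    also have "\<dots> = c * (LINT y|lborel. \<psi> y * complex_of_real (E s y))"
      using True \<psi> by (simp only: fourier_density_distr atLeastAtMost_iff c_def E_def)
    finally show ?thesis
      using True by (simp add: G_def k_def)
  qed (simp add: G_def k_def)
  have "integrable lborel (\<lambda>s. LINT y|lborel. G s y)"
    using lborel_pair.integrable_fst'[OF int] by simp
  then show ?int
    unfolding set_integrable_def integrand by (rule integrable_mult_right)
  \<comment> \<open>For fixed y this is the scalar equation with c = - y^2; the factor c it requires
    is the - y^2 contained in \<psi>.\<close>
  have inner: "(LINT s|lborel. G s y) = complex_of_real (Gamma \<beta>) * (\<phi> y * complex_of_real (E t y) - \<phi> y)" for y
  proof -
    have "(LINT s|lborel. G s y) = (LINT s|lborel. complex_of_real (k s * E s y) * \<psi> y)"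
      by (simp add: G_def mult_ac)
    also have "\<dots> = complex_of_real (LINT s|lborel. k s * E s y) * \<psi> y"
      unfolding integral_mult_left_zero integral_complex_of_real ..
    also have "\<dots> = complex_of_real (- y\<^sup>2 * (LINT s|lborel. k s * E s y)) * \<phi> y"
      by (simp add: \<psi>_def)
    also have "(LINT s|lborel. k s * E s y)
        = (LINT s:{0..t}|lborel. stretched_kernel \<alpha> \<beta> t s * Mittag_Leffler \<beta> (- y\<^sup>2 * s powr \<alpha>))"
      by (simp add: set_lebesgue_integral_def k_def E_def mult.assoc)
    also have "- y\<^sup>2 * \<dots> = Gamma \<beta> * (E t y - 1)"
      unfolding Mittag_Leffler_stretched_equation[OF \<alpha>(1) \<beta> t] by (simp add: E_def)
    finally show ?thesis by (simp add: algebra_simps)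
  qed
  have intE: "integrable lborel (\<lambda>y. \<phi> y * complex_of_real (E t y))"
  proof (rule Bochner_Integration.integrable_bound[OF schwartz_space_integrable[OF \<phi>]])
    show "(\<lambda>y. \<phi> y * complex_of_real (E t y)) \<in> borel_measurable lborel"
      unfolding E_def by measurable
    show "AE y in lborel. norm (\<phi> y * complex_of_real (E t y)) \<le> norm (\<phi> y)"
      using Mittag_Leffler_le_1[of t] t
      by (intro AE_I2) (auto simp: norm_mult E_def intro!: mult_right_le_one_le)
  qed
  have "(LINT s:{0..t}|lborel. complex_of_real (stretched_kernel \<alpha> \<beta> t s) *
          mult_distr (\<lambda>y. - (complex_of_real y)\<^sup>2) (fourier_distr (density_distr f s)) \<phi>)
      = c * (LINT s|lborel. LINT y|lborel. G s y)"
    unfolding set_lebesgue_integral_def integrand by simp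
  also have "(LINT s|lborel. LINT y|lborel. G s y) = (LINT y|lborel. LINT s|lborel. G s y)"
    by (rule lborel_pair.Fubini_integral[OF int, symmetric])
  also have "\<dots> = complex_of_real (Gamma \<beta>) *
      ((LINT y|lborel. \<phi> y * complex_of_real (E t y)) - (LINT y|lborel. \<phi> y))"
    unfolding inner using intE schwartz_space_integrable[OF \<phi>] by simp
  finally have "complex_of_real (1 / Gamma \<beta>) * (LINT s:{0..t}|lborel. complex_of_real (stretched_kernel \<alpha> \<beta> t s) *
          mult_distr (\<lambda>y. - (complex_of_real y)\<^sup>2) (fourier_distr (density_distr f s)) \<phi>)
      = c * ((LINT y|lborel. \<phi> y * complex_of_real (E t y)) - (LINT y|lborel. \<phi> y))"
    using Gamma_real_pos[OF \<beta>] by simp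
  moreover have "fourier_distr dirac_distr \<phi> = c * (LINT y|lborel. \<phi> y)"
    using \<phi> fourier_schwartz_space[OF \<phi>]
    by (simp add: fourier_distr_def dirac_distr_def fourier_def c_def)
  moreover have "fourier_distr (density_distr f t) \<phi> = c * (LINT y|lborel. \<phi> y * complex_of_real (E t y))"
    using fourier_density_distr[OF _ \<phi>, of t] t by (simp add: c_def E_def)
  ultimately show ?eq by (simp add: right_diff_distrib)
qed

end

theorem proposition4p1:
  fixes \<alpha> \<beta> :: real
    and \<mu> :: "((real \<Rightarrow> real) \<Rightarrow> real) measure"
    and X :: "(nat \<Rightarrow> real \<Rightarrow> real) set \<Rightarrow> ((real \<Rightarrow> real) \<Rightarrow> real) \<Rightarrow> real"
    and f :: "real \<Rightarrow> real \<Rightarrow> real"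
  assumes "0 < \<alpha>" "\<alpha> < 2" "0 < \<beta>" "\<beta> \<le> 1"
    and "is_grey_measure \<alpha> \<beta> \<mu>"
    and "is_grey_noise \<alpha> \<mu> X"
    and "is_marginal_density \<alpha> \<mu> X f"
  shows "is_fundamental_solution \<alpha> \<beta> (density_distr f)"
proof -
  interpret grey_brownian_motion \<alpha> \<beta> \<mu> X f
    using assms by unfold_locales
  \<comment> \<open>At t = 0 only s = 0 is integrated over, and there the kernel is 0 because
    \<open>0 powr a\<close> is 0. The equation then reduces to the initial datum.\<close>
  have zero: "indicator {0..0} s *\<^sub>R (complex_of_real (stretched_kernel \<alpha> \<beta> 0 s) * z) = 0" for s z
    by (simp add: stretched_kernel_def indicator_def)
  show ?thesis
    unfolding is_fundamental_solution_def solves_stretched_equation_def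
  proof (intro conjI allI impI ballI dirac_distr_tempered density_distr_tempered)
    fix t :: real and \<phi> :: "real \<Rightarrow> complex"
    assume t: "0 \<le> t" and \<phi>: "\<phi> \<in> schwartz_space"
    show "set_integrable lborel {0..t} (\<lambda>s. complex_of_real (stretched_kernel \<alpha> \<beta> t s) *
        mult_distr (\<lambda>y. - (complex_of_real y)\<^sup>2) (fourier_distr (density_distr f s)) \<phi>)"
    proof (cases "t = 0")
      case True
      then show ?thesis unfolding set_integrable_def by (simp only: zero integrable_zero)
    next
      case False
      then show ?thesis using t \<phi> by (intro density_distr_equation(1)) auto
    qed
    show "fourier_distr (density_distr f t) \<phi> =
      fourier_distr dirac_distr \<phi> + complex_of_real (1 / Gamma \<beta>) *
        (LINT s:{0..t}|lborel. complex_of_real (stretched_kernel \<alpha> \<beta> t s) *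
          mult_distr (\<lambda>y. - (complex_of_real y)\<^sup>2) (fourier_distr (density_distr f s)) \<phi>)"
    proof (cases "t = 0")
      case True
      have "density_distr f 0 = dirac_distr" by (simp add: density_distr_def)
      then show ?thesis
        unfolding True set_lebesgue_integral_def zero by simp
    next
      case False
      then show ?thesis using t \<phi> by (intro density_distr_equation(2)) auto
    qed
  qed
qed

end
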